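(* Let $k>1$ be an integer, let $X$ and $Y$ be real Banach spaces and suppose that $X$ is a nontrivial $M$-ideal in $Y$. Then $\widehat{\bigotimes}^{k,s}_{\varepsilon_{k,s}}X$ is not an $M$-ideal in $\widehat{\bigotimes}^{k,s}_{\varepsilon_{k,s}}Y$.
   Context: A closed subspace $X$ of a Banach space $Y$ is an $M$-ideal in $Y$ if $Y^*=X^\perp\oplus_1 X^\sharp$ (an $\ell_1$-direct sum), where $X^\perp\subset Y^*$ is the annihilator of $X$ and $X^\sharp$ is a closed subspace of $Y^*$. Nontrivial means $\{0\}\neq X\neq Y$. For a Banach space $X$, $\bigotimes^{k,s}X$ is the linear span of the elementary tensors $\otimes^kx=x\otimes\cdots\otimes x$ in the $k$-fold tensor product of $X$; the symmetric injective norm is $\varepsilon_{k,s}(v)=\sup_{\phi\in B_{X^*}}\left|\sum_{j=1}^r\lambda_j\phi(x_j)^k\right|$ for any representation $v=\sum_{j=1}^r\lambda_j\otimes^kx_j$, and $\widehat{\bigotimes}^{k,s}_{\varepsilon_{k,s}}X$ is the completion of $\bigotimes^{k,s}X$ for this norm. For a closed subspace $X\subset Y$ with inclusion $i$, the map $\otimes^{k,s}i\colon\otimes^kx\mapsto\otimes^k i(x)$ is isometric for these norms, so $\widehat{\bigotimes}^{k,s}_{\varepsilon_{k,s}}X$ is regarded as a closed subspace of $\widehat{\bigotimes}^{k,s}_{\varepsilon_{k,s}}Y$. *)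

theory Defs
  imports "HOL-Analysis.Analysis"
begin

subsection \<open>M-ideals\<close>

definition annihilator :: "'a::real_normed_vector set \<Rightarrow> ('a \<Rightarrow>\<^sub>L real) set" where
  "annihilator X = {f. \<forall>x\<in>X. blinfun_apply f x = 0}"

definition l1_direct_sum :: "'a::real_normed_vector set \<Rightarrow> 'a set \<Rightarrow> bool" where
  "l1_direct_sum U V \<longleftrightarrow> (\<forall>z. \<exists>u\<in>U. \<exists>v\<in>V. z = u + v) \<and> U \<inter> V = {0} \<and>
     (\<forall>u\<in>U. \<forall>v\<in>V. norm (u + v) = norm u + norm v)"

definition M_ideal :: "'a::banach set \<Rightarrow> bool" where
  "M_ideal X \<longleftrightarrow> subspace X \<and> closed X \<and>
     (\<exists>X'. subspace X' \<and> closed X' \<and> l1_direct_sum (annihilator X) X')"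

subsection \<open>Hahn--Banach theorems\<close>

text \<open>
  Two forms of the Hahn--Banach theorem, both obtained from a linear functional below a given
  sublinear functional (a minimal sublinear functional is linear).
\<close>

definition sublin :: "('a::real_normed_vector \<Rightarrow> real) \<Rightarrow> bool" where
  "sublin p \<longleftrightarrow> (\<forall>x y. p (x + y) \<le> p x + p y) \<and> (\<forall>t x. 0 \<le> t \<longrightarrow> p (t *\<^sub>R x) = t * p x) \<and>
     (\<forall>x. p x \<le> norm x)"

lemma sublin_lower:
  assumes "sublin p" shows "- norm x \<le> p x"
proof -
  have "p (x + - x) \<le> p x + p (- x)" "p (0 *\<^sub>R x) = 0 * p x" "p (- x) \<le> norm (- x)"
    using assms unfolding sublin_def by blast+
  then show ?thesis by simp
qed

lemma sublin_zero: "sublin p \<Longrightarrow> p 0 = 0"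
  unfolding sublin_def by (metis mult_zero_left order_refl scaleR_zero_left)

lemma sublin_reduce:
  assumes p: "sublin p"
  obtains q where "sublin q" "\<And>x. q x \<le> p x" "q (- a) \<le> - p a"
proof -
  define h where "h t y = p (y + t *\<^sub>R a) - t * p a" for t y
  define q where "q y = (INF t\<in>{0..}. h t y)" for y
  have add: "p (x + y) \<le> p x + p y" for x y using p by (simp add: sublin_def)
  have hom: "0 \<le> t \<Longrightarrow> p (t *\<^sub>R x) = t * p x" for t x using p by (simp add: sublin_def)
  have p0: "p 0 = 0" by (rule sublin_zero[OF p])
  have lower: "- p (- y) \<le> h t y" if "0 \<le> t" for t y
    using add[of "y + t *\<^sub>R a" "- y"] hom[OF that, of a] by (simp add: h_def)
  have bdd: "bdd_below ((\<lambda>t. h t y) ` {0..})" for y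
    using lower by (auto intro!: bdd_belowI2)
  have qle: "q y \<le> h t y" if "0 \<le> t" for t y
    unfolding q_def by (rule cINF_lower[OF bdd]) (use that in auto)
  have qge: "c \<le> q y" if "\<And>t. 0 \<le> t \<Longrightarrow> c \<le> h t y" for c y
    unfolding q_def by (rule cINF_greatest) (use that in auto)
  have qp: "q y \<le> p y" for y using qle[of 0 y] by (simp add: h_def)
  have qadd: "q (x + y) \<le> q x + q y" for x y
  proof -
    have "q (x + y) - h t y \<le> q x" if t: "0 \<le> t" for t
    proof (rule qge)
      fix s :: real assume s: "0 \<le> s"
      have "q (x + y) \<le> h (s + t) (x + y)" using s t by (intro qle) simp
      also have "\<dots> \<le> h s x + h t y"
        using add[of "x + s *\<^sub>R a" "y + t *\<^sub>R a"] by (simp add: h_def algebra_simps)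
      finally show "q (x + y) - h t y \<le> h s x" by simp
    qed
    then have "q (x + y) - q x \<le> h t y" if "0 \<le> t" for t using that by fastforce
    then have "q (x + y) - q x \<le> q y" by (rule qge)
    then show ?thesis by simp
  qed
  have hh: "h (s * t) (s *\<^sub>R y) = s * h t y" if "0 \<le> s" for s t y
    using hom[OF that, of "y + t *\<^sub>R a"] by (simp add: h_def algebra_simps)
  have qhom: "q (s *\<^sub>R y) = s * q y" if s: "0 \<le> s" for s y
  proof (cases "s = 0")
    case True
    have "q 0 = 0"
    proof (rule antisym)
      show "q 0 \<le> 0" using qp[of 0] p0 by simp
      show "0 \<le> q 0" by (rule qge) (simp add: h_def hom)
    qed
    then show ?thesis using True by simp
  next
    case False
    with s have s: "0 < s" by simp
    show ?thesis
    proof (rule antisym)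
      have "q (s *\<^sub>R y) / s \<le> q y"
      proof (rule qge)
        fix t :: real assume "0 \<le> t"
        then have "q (s *\<^sub>R y) \<le> h (s * t) (s *\<^sub>R y)" using s by (intro qle) simp
        then show "q (s *\<^sub>R y) / s \<le> h t y" using hh[of s t y] s by (simp add: field_simps)
      qed
      then show "q (s *\<^sub>R y) \<le> s * q y" using s by (simp add: field_simps)
      show "s * q y \<le> q (s *\<^sub>R y)"
      proof (rule qge)
        fix t :: real assume t: "0 \<le> t"
        have "s * q y \<le> s * h (t / s) y" using s t by (intro mult_left_mono qle) auto
        also have "\<dots> = h t (s *\<^sub>R y)" using hh[of s "t / s" y] s by simp
        finally show "s * q y \<le> h t (s *\<^sub>R y)" .
      qed
    qed
  qed
  have "sublin q"
    unfolding sublin_def using qadd qhom qp p by (meson order_trans sublin_def)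
  moreover have "q (- a) \<le> - p a" using qle[of 1 "- a"] p0 by (simp add: h_def)
  ultimately show ?thesis using qp that by blast
qed

lemma sublin_dominates_functional:
  fixes q0 :: "'a::real_normed_vector \<Rightarrow> real"
  assumes q0: "sublin q0"
  obtains f :: "'a \<Rightarrow>\<^sub>L real" where "norm f \<le> 1" "\<And>x. f x \<le> q0 x"
proof -
  define A where "A = {p. sublin p \<and> p \<le> q0}"
  have "\<exists>m\<in>A. \<forall>a\<in>A. m \<ge> a \<longrightarrow> a = m"
  proof (rule predicate_Zorn)
    show "partial_order_on A (relation_of (\<ge>) A)"
      by (rule partial_order_on_relation_ofI) auto
  next
    fix C assume C: "C \<in> Chains (relation_of (\<ge>) A)"
    show "\<exists>u\<in>A. \<forall>a\<in>C. u \<le> a"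
    proof (cases "C = {}")
      case True
      then show ?thesis using q0 by (auto simp: A_def)
    next
      case False
      have CA: "sublin p" "p \<le> q0" if "p \<in> C" for p
        using C that by (auto simp: Chains_def relation_of_def A_def)
      have Cl: "p \<le> p' \<or> p' \<le> p" if "p \<in> C" "p' \<in> C" for p p'
        using C that by (auto simp: Chains_def relation_of_def)
      define u where "u y = (INF p\<in>C. p y)" for y
      have bdd: "bdd_below ((\<lambda>p. p y) ` C)" for y
        using CA sublin_lower by (auto intro!: bdd_belowI2[of _ "- norm y"])
      have ule: "u y \<le> p y" if "p \<in> C" for p y
        unfolding u_def by (rule cINF_lower[OF bdd that])
      have uge: "c \<le> u y" if "\<And>p. p \<in> C \<Longrightarrow> c \<le> p y" for c y
        unfolding u_def by (rule cINF_greatest[OF False]) (use that in auto)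
      obtain p0 where p0: "p0 \<in> C" using False by blast
      have "u (a + b) \<le> u a + u b" for a b
      proof -
        have *: "u (a + b) \<le> p a + p' b" if pp: "p \<in> C" "p' \<in> C" for p p'
        proof -
          obtain r where r: "r \<in> C" "r \<le> p" "r \<le> p'" using Cl[OF pp] pp by auto
          have "u (a + b) \<le> r (a + b)" by (rule ule[OF r(1)])
          also have "\<dots> \<le> r a + r b" using CA[OF r(1)] by (simp add: sublin_def)
          also have "\<dots> \<le> p a + p' b" using r by (simp add: le_funD add_mono)
          finally show ?thesis .
        qed
        have "u (a + b) - p' b \<le> u a" if "p' \<in> C" for p'
          by (rule uge) (use * that in force)
        then have "u (a + b) - u a \<le> u b" by (intro uge) fastforce
        then show ?thesis by simp
      qed
      moreover have "u (t *\<^sub>R y) = t * u y" if t: "0 \<le> t" for t y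
      proof (cases "t = 0")
        case True
        have "u 0 = 0" using ule[OF p0, of 0] uge[of 0 0] sublin_zero CA p0
          by (metis order_antisym order_refl)
        then show ?thesis using True by simp
      next
        case False
        with t have t: "0 < t" by simp
        have eq: "p (t *\<^sub>R y) = t * p y" if "p \<in> C" for p
          using CA(1)[OF that] t by (simp add: sublin_def)
        show ?thesis
        proof (rule antisym)
          have "u (t *\<^sub>R y) / t \<le> u y"
          proof (rule uge)
            fix p assume "p \<in> C"
            then show "u (t *\<^sub>R y) / t \<le> p y"
              using ule[of p "t *\<^sub>R y"] eq[of p] t by (simp add: field_simps)
          qed
          then show "u (t *\<^sub>R y) \<le> t * u y" using t by (simp add: field_simps)
          show "t * u y \<le> u (t *\<^sub>R y)"
          proof (rule uge)
            fix p assume "p \<in> C"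
            then show "t * u y \<le> p (t *\<^sub>R y)" using ule[of p y] eq[of p] t by simp
          qed
        qed
      qed
      moreover have uq: "u y \<le> q0 y" for y
        using ule[OF p0, of y] le_funD[OF CA(2)[OF p0], of y] by simp
      moreover have "u y \<le> norm y" for y
        using order_trans[OF uq, of y "norm y"] q0(1) by (simp add: sublin_def)
      ultimately have "u \<in> A" unfolding A_def sublin_def
        by (auto intro: le_funI order_trans)
      then show ?thesis using ule by (auto intro!: bexI[of _ u] le_funI)
    qed
  qed
  then obtain m where m: "sublin m" "m \<le> q0" and min: "\<And>p. sublin p \<Longrightarrow> p \<le> m \<Longrightarrow> p = m"
    unfolding A_def by (auto intro: order_trans)
  have neg: "m (- a) = - m a" for a
  proof -
    obtain q where "sublin q" "\<And>x. q x \<le> m x" "q (- a) \<le> - m a"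
      using sublin_reduce[OF m(1)] by blast
    then have "m (- a) \<le> - m a" using min[of q] by (auto simp: le_fun_def)
    moreover have "m (a + - a) \<le> m a + m (- a)" using m(1) unfolding sublin_def by blast
    ultimately show ?thesis using sublin_zero[OF m(1)] by simp
  qed
  have add: "m (a + b) \<le> m a + m b" for a b using m(1) by (simp add: sublin_def)
  have add_eq: "m (a + b) = m a + m b" for a b
    using add[of a b] add[of "- a" "- b"] neg[of "a + b"] neg by simp
  have hom: "m (t *\<^sub>R a) = t * m a" for t a
  proof (cases "0 \<le> t")
    case True
    then show ?thesis using m(1) by (simp add: sublin_def)
  next
    case False
    moreover have "\<And>s y. 0 \<le> s \<Longrightarrow> m (s *\<^sub>R y) = s * m y" using m(1) by (simp add: sublin_def)
    ultimately have "m ((- t) *\<^sub>R a) = (- t) * m a" by (metis linorder_le_cases neg_0_le_iff_le)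
    then show ?thesis using neg[of "t *\<^sub>R a"] by simp
  qed
  have bd: "\<bar>m a\<bar> \<le> norm a" for a
    using sublin_lower[OF m(1), of a] m(1) by (simp add: sublin_def abs_le_iff)
  have bl: "bounded_linear m"
    by (rule bounded_linear_intro[where K=1]) (use add_eq hom bd in auto)
  show ?thesis
  proof
    show "norm (Blinfun m) \<le> 1"
      by (rule norm_blinfun_bound) (use bd in \<open>auto simp: bounded_linear_Blinfun_apply[OF bl]\<close>)
    show "blinfun_apply (Blinfun m) x \<le> q0 x" for x
      using le_funD[OF m(2)] by (simp add: bounded_linear_Blinfun_apply[OF bl])
  qed
qed

lemma hahn_banach_norming:
  fixes x :: "'a::real_normed_vector"
  obtains f :: "'a \<Rightarrow>\<^sub>L real" where "norm f \<le> 1" "f x = norm x"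
proof -
  have "sublin (norm :: 'a \<Rightarrow> real)" by (auto simp: sublin_def norm_triangle_ineq)
  then obtain q where q: "sublin q" "q (- x) \<le> - norm x"
    using sublin_reduce by blast
  obtain f :: "'a \<Rightarrow>\<^sub>L real" where f: "norm f \<le> 1" "\<And>x. f x \<le> q x"
    using sublin_dominates_functional[OF q(1)] by blast
  have "norm x \<le> f x" using f(2)[of "- x"] q(2) by (simp add: blinfun.minus_right)
  moreover have "f x \<le> norm x"
    using f(2)[of x] q(1) by (auto simp: sublin_def intro: order_trans)
  ultimately show ?thesis using f(1) that by force
qed

lemma hahn_banach_extension:
  fixes i :: "'a::real_normed_vector \<Rightarrow>\<^sub>L 'b::real_normed_vector" and \<psi> :: "'a \<Rightarrow>\<^sub>L real"
  assumes iso: "\<And>x. norm (i x) = norm x" and \<psi>: "norm \<psi> \<le> 1"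
  obtains f :: "'b \<Rightarrow>\<^sub>L real" where "norm f \<le> 1" "\<And>x. f (i x) = \<psi> x"
proof -
  define h where "h x y = \<psi> x + norm (y - i x)" for x y
  define q where "q y = (INF x. h x y)" for y
  have \<psi>le: "\<bar>\<psi> x\<bar> \<le> norm x" for x
    using norm_blinfun[of \<psi> x] \<psi> by (metis mult_left_le_one_le norm_ge_zero order_trans real_norm_def)
  have "- norm y \<le> h x y" for x y
    using \<psi>le[of x] iso[of x] norm_triangle_ineq4[of y "y - i x"] by (simp add: h_def)
  then have bdd: "bdd_below (range (\<lambda>x. h x y))" for y by (auto intro!: bdd_belowI2)
  have qle: "q y \<le> h x y" for x y unfolding q_def by (rule cINF_lower[OF bdd]) simp
  have qge: "c \<le> q y" if "\<And>x. c \<le> h x y" for c y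
    unfolding q_def by (rule cINF_greatest) (use that in auto)
  have qnorm: "q y \<le> norm y" for y using qle[of y 0] by (simp add: h_def)
  have qadd: "q (y + z) \<le> q y + q z" for y z
  proof -
    have *: "q (y + z) \<le> h a y + h b z" for a b
    proof -
      have "q (y + z) \<le> h (a + b) (y + z)" by (rule qle)
      also have "\<dots> \<le> h a y + h b z"
        using norm_triangle_ineq[of "y - i a" "z - i b"] by (simp add: h_def blinfun.add_right algebra_simps)
      finally show ?thesis .
    qed
    have "q (y + z) - h b z \<le> q y" for b by (rule qge) (use * in \<open>simp add: algebra_simps\<close>)
    then have "q (y + z) - q y \<le> q z" by (intro qge) (simp add: algebra_simps)
    then show ?thesis by simp
  qed
  have hh: "h (s *\<^sub>R x) (s *\<^sub>R y) = s * h x y" if "0 \<le> s" for s x y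
    using that by (simp add: h_def blinfun.scaleR_right algebra_simps flip: scaleR_diff_right)
  have qhom1: "s * q y \<le> q (s *\<^sub>R y)" if s: "0 < s" for s y
  proof (rule qge)
    fix x
    have "s * q y \<le> s * h ((1 / s) *\<^sub>R x) y" using s by (intro mult_left_mono qle) auto
    also have "\<dots> = h x (s *\<^sub>R y)" using hh[of s "(1 / s) *\<^sub>R x" y] s by simp
    finally show "s * q y \<le> h x (s *\<^sub>R y)" .
  qed
  have q0: "q 0 = 0"
  proof (rule antisym)
    show "q 0 \<le> 0" using qnorm[of 0] by simp
    show "0 \<le> q 0" by (rule qge) (use \<psi>le iso in \<open>simp add: h_def, smt (verit)\<close>)
  qed
  have qhom: "q (s *\<^sub>R y) = s * q y" if s: "0 \<le> s" for s y
  proof (cases "s = 0")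
    case False
    then have "(1 / s) * q (s *\<^sub>R y) \<le> q y" using qhom1[of "1 / s" "s *\<^sub>R y"] s by simp
    then have "q (s *\<^sub>R y) \<le> s * q y" using s False by (simp add: field_simps)
    then show ?thesis using qhom1[of s y] s False by simp
  qed (simp add: q0)
  have "sublin q" unfolding sublin_def using qadd qhom qnorm by blast
  then obtain f :: "'b \<Rightarrow>\<^sub>L real" where f: "norm f \<le> 1" "\<And>y. f y \<le> q y"
    using sublin_dominates_functional by blast
  have le: "f (i x) \<le> \<psi> x" for x
    using order_trans[OF f(2) qle[of "i x" x]] by (simp add: h_def)
  have "f (i x) = \<psi> x" for x
    using le[of x] le[of "- x"] by (simp add: blinfun.minus_right)
  then show ?thesis using f(1) that by blast
qed

subsection \<open>Tensor powers of a vector space\<close>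

definition multilinear :: "(('k \<Rightarrow> 'a::real_vector) \<Rightarrow> 'c::real_vector) \<Rightarrow> bool" where
  "multilinear A \<longleftrightarrow> (\<forall>v i. linear (\<lambda>x. A (v(i := x))))"

text \<open>
  The algebraic tensor product of copies of \<open>'a\<close>, one for each index in \<open>'k\<close> (so the
  \<open>k\<close>-fold tensor product if \<open>CARD('k) = k\<close>): finite linear combinations of elementary tensors,
  where \<open>tensor v\<close> is the evaluation at \<open>v\<close> of multilinear forms. The value \<open>0\<close> at functions that
  are not multilinear is a dummy. The universal property is \<open>tensor_universal\<close> below.
\<close>

typedef (overloaded) ('k, 'a::real_vector) tensor =
  "{t :: (('k \<Rightarrow> 'a) \<Rightarrow> real) \<Rightarrow> real.
     \<exists>cvs. \<forall>A. t A = (if multilinear A then \<Sum>(c, v)\<leftarrow>cvs. c * A v else 0)}"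
  by (rule exI[of _ "\<lambda>A. 0"], simp, rule exI[of _ "[]"], simp)

setup_lifting type_definition_tensor

instantiation tensor :: (type, real_vector) real_vector
begin

lift_definition zero_tensor :: "('a, 'b) tensor" is "\<lambda>A. 0"
  by (rule exI[of _ "[]"]) simp

lift_definition plus_tensor :: "('a, 'b) tensor \<Rightarrow> ('a, 'b) tensor \<Rightarrow> ('a, 'b) tensor"
  is "\<lambda>s t A. s A + t A"
proof -
  fix s t :: "(('a \<Rightarrow> 'b) \<Rightarrow> real) \<Rightarrow> real"
  assume "\<exists>cvs. \<forall>A. s A = (if multilinear A then \<Sum>(c, v)\<leftarrow>cvs. c * A v else 0)"
    "\<exists>cvs. \<forall>A. t A = (if multilinear A then \<Sum>(c, v)\<leftarrow>cvs. c * A v else 0)"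
  then obtain ss ts where
    "\<forall>A. s A = (if multilinear A then \<Sum>(c, v)\<leftarrow>ss. c * A v else 0)"
    "\<forall>A. t A = (if multilinear A then \<Sum>(c, v)\<leftarrow>ts. c * A v else 0)" by blast
  then show "\<exists>cvs. \<forall>A. s A + t A = (if multilinear A then \<Sum>(c, v)\<leftarrow>cvs. c * A v else 0)"
    by (intro exI[of _ "ss @ ts"]) simp
qed

lift_definition scaleR_tensor :: "real \<Rightarrow> ('a, 'b) tensor \<Rightarrow> ('a, 'b) tensor"
  is "\<lambda>r t A. r * t A"
proof -
  fix r and t :: "(('a \<Rightarrow> 'b) \<Rightarrow> real) \<Rightarrow> real"
  assume "\<exists>cvs. \<forall>A. t A = (if multilinear A then \<Sum>(c, v)\<leftarrow>cvs. c * A v else 0)"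
  then obtain ts where
    "\<forall>A. t A = (if multilinear A then \<Sum>(c, v)\<leftarrow>ts. c * A v else 0)" by blast
  then show "\<exists>cvs. \<forall>A. r * t A = (if multilinear A then \<Sum>(c, v)\<leftarrow>cvs. c * A v else 0)"
    by (intro exI[of _ "map (\<lambda>(c, v). (r * c, v)) ts"])
      (simp add: sum_list_const_mult[symmetric] o_def case_prod_beta mult.assoc)
qed

definition uminus_tensor :: "('a, 'b) tensor \<Rightarrow> ('a, 'b) tensor" where
  "uminus_tensor t = (- 1) *\<^sub>R t"

definition minus_tensor :: "('a, 'b) tensor \<Rightarrow> ('a, 'b) tensor \<Rightarrow> ('a, 'b) tensor" where
  "minus_tensor s t = s + - t"

instance
  by standard
    (unfold uminus_tensor_def minus_tensor_def, (transfer, simp add: fun_eq_iff algebra_simps)+)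

end

lift_definition tensor :: "('k \<Rightarrow> 'a::real_vector) \<Rightarrow> ('k, 'a) tensor"
  is "\<lambda>v A. if multilinear A then A v else 0"
  by (rule_tac x="[(1, fun)]" in exI) simp

lemma Rep_tensor_sum: "Rep_tensor (sum f S) A = (\<Sum>j\<in>S. Rep_tensor (f j) A)"
  by (induction S rule: infinite_finite_induct) (auto simp: zero_tensor.rep_eq plus_tensor.rep_eq)

lemma Rep_tensor_sum_list: "Rep_tensor (sum_list ts) A = (\<Sum>t\<leftarrow>ts. Rep_tensor t A)"
  by (induction ts) (auto simp: zero_tensor.rep_eq plus_tensor.rep_eq)

lemma tensor_eq_sum_list: "\<exists>cvs. t = (\<Sum>(c, v)\<leftarrow>cvs. c *\<^sub>R tensor v)"
proof -
  obtain cvs where "\<forall>A. Rep_tensor t A = (if multilinear A then \<Sum>(c, v)\<leftarrow>cvs. c * A v else 0)"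
    using Rep_tensor[of t] by blast
  moreover have "Rep_tensor (\<Sum>(c, v)\<leftarrow>cvs. c *\<^sub>R tensor v) A =
      (if multilinear A then \<Sum>(c, v)\<leftarrow>cvs. c * A v else 0)" for A
    unfolding Rep_tensor_sum_list
    by (induction cvs) (auto simp: scaleR_tensor.rep_eq tensor.rep_eq)
  ultimately have "t = (\<Sum>(c, v)\<leftarrow>cvs. c *\<^sub>R tensor v)"
    by (intro Rep_tensor_inject[THEN iffD1] ext) simp
  then show ?thesis by blast
qed

lemma multilinear_tensor: "multilinear (tensor :: ('k \<Rightarrow> 'a::real_vector) \<Rightarrow> _)"
proof -
  have "Rep_tensor (tensor (v(i := x + y))) A
      = Rep_tensor (tensor (v(i := x)) + tensor (v(i := y))) A"
    "Rep_tensor (tensor (v(i := r *\<^sub>R x))) A = Rep_tensor (r *\<^sub>R tensor (v(i := x))) A"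
    for v :: "'k \<Rightarrow> 'a" and i x y r A
    by (auto simp: tensor.rep_eq plus_tensor.rep_eq scaleR_tensor.rep_eq multilinear_def
        linear_add linear_scale dest!: spec[of _ v] spec[of _ i]
        intro: linear_add[of "\<lambda>x. A (v(i := x))"] linear_scale[of "\<lambda>x. A (v(i := x))", simplified])
  then show ?thesis unfolding multilinear_def
    by (intro allI linearI) (simp_all add: Rep_tensor_inject[symmetric] fun_eq_iff)
qed

lemma multilinear_compose_linear: "multilinear A \<Longrightarrow> linear f \<Longrightarrow> multilinear (\<lambda>v. f (A v))"
  unfolding multilinear_def by (metis linear_compose[unfolded o_def])

lemma tensor_universal:
  fixes A :: "('k \<Rightarrow> 'a::real_vector) \<Rightarrow> 'c::real_vector"
  assumes A: "multilinear A"
  shows "\<exists>!L. linear L \<and> (\<forall>v. L (tensor v) = A v)"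
proof -
  define R where "R t cvs \<longleftrightarrow> t = (\<Sum>(c, v)\<leftarrow>cvs. c *\<^sub>R tensor v)" for t and cvs :: "(real \<times> ('k \<Rightarrow> 'a)) list"
  define E where "E cvs = (\<Sum>(c, v)\<leftarrow>cvs. c *\<^sub>R A v)" for cvs
  have lin: "F (\<Sum>(c, v)\<leftarrow>cvs. c *\<^sub>R G v) = (\<Sum>(c, v)\<leftarrow>cvs. c *\<^sub>R F (G v))"
    if "linear F" for F :: "'d::real_vector \<Rightarrow> 'e::real_vector" and G and cvs :: "(real \<times> ('k \<Rightarrow> 'a)) list"
    using that by (induction cvs) (auto simp: linear_0 linear_add linear_scale)
  have fE: "f (E cvs) = Rep_tensor t (\<lambda>v. f (A v))" if "R t cvs" "linear f" for t cvs and f :: "'c \<Rightarrow> real"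
  proof -
    have "multilinear (\<lambda>v. f (A v))" using A that(2) by (rule multilinear_compose_linear)
    then have "Rep_tensor t (\<lambda>v. f (A v)) = (\<Sum>(c, v)\<leftarrow>cvs. c * f (A v))"
      unfolding that(1)[unfolded R_def] Rep_tensor_sum_list
      by (induction cvs) (auto simp: scaleR_tensor.rep_eq tensor.rep_eq)
    then show ?thesis using lin[OF that(2)] by (simp add: E_def)
  qed
  have sep: "x = y" if "\<And>f :: 'c \<Rightarrow> real. linear f \<Longrightarrow> f x = f y" for x y
  proof (rule ccontr)
    assume "x \<noteq> y"
    then have "independent {x - y}" by simp
    then obtain f where "linear f" "\<forall>z\<in>{x - y}. f z = (1::real)"
      using linear_independent_extend[of "{x - y}" "\<lambda>_. 1"] by blast
    then show False using that[of f] by (simp add: linear_diff)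
  qed
  have E_unique: "E c1 = E c2" if "R t c1" "R t c2" for t c1 c2
    by (rule sep) (use fE that in metis)
  define L where "L t = E (SOME cvs. R t cvs)" for t
  have LE: "L t = E cvs" if "R t cvs" for t cvs
    unfolding L_def using that by (metis E_unique someI)
  have ex: "\<exists>cvs. R t cvs" for t unfolding R_def by (rule tensor_eq_sum_list)
  have "linear L"
  proof (rule linearI)
    fix s t :: "('k, 'a) tensor" and r :: real
    obtain ss ts where *: "R s ss" "R t ts" using ex by blast
    then have "R (s + t) (ss @ ts)" by (simp add: R_def)
    then show "L (s + t) = L s + L t" using * by (simp add: LE E_def)
    have "R (r *\<^sub>R s) (map (\<lambda>(c, v). (r * c, v)) ss)"
      using *(1) unfolding R_def by (simp add: o_def case_prod_beta)
        (induction ss arbitrary: s, auto simp: scaleR_add_right)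
    then have "L (r *\<^sub>R s) = E (map (\<lambda>(c, v). (r * c, v)) ss)" by (rule LE)
    also have "\<dots> = r *\<^sub>R E ss"
      unfolding E_def by (induction ss) (auto simp: scaleR_add_right)
    finally show "L (r *\<^sub>R s) = r *\<^sub>R L s" using * by (simp add: LE)
  qed
  moreover have "L (tensor v) = A v" for v
    using LE[of "tensor v" "[(1, v)]"] by (simp add: R_def E_def)
  moreover have "L' = L" if "linear L'" "\<forall>v. L' (tensor v) = A v" for L'
  proof
    fix t obtain cvs where "R t cvs" using ex by blast
    then show "L' t = L t" using lin[OF that(1)] that(2) by (simp add: R_def LE E_def)
  qed
  ultimately show ?thesis by blast
qed

subsection \<open>Symmetric tensors and the symmetric injective norm\<close>

definition tensor_power :: "'a::real_vector \<Rightarrow> ('k, 'a) tensor" where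
  "tensor_power x = tensor (\<lambda>_. x)"

typedef (overloaded) ('k, 'a::real_vector) sym_tensor =
  "span (range tensor_power) :: ('k, 'a) tensor set"
  using span_zero by blast

setup_lifting type_definition_sym_tensor

instantiation sym_tensor :: (type, real_vector) real_vector
begin

lift_definition zero_sym_tensor :: "('a, 'b) sym_tensor" is 0 by (rule span_zero)

lift_definition plus_sym_tensor :: "('a, 'b) sym_tensor \<Rightarrow> ('a, 'b) sym_tensor \<Rightarrow> ('a, 'b) sym_tensor"
  is "(+)" by (rule span_add)

lift_definition minus_sym_tensor :: "('a, 'b) sym_tensor \<Rightarrow> ('a, 'b) sym_tensor \<Rightarrow> ('a, 'b) sym_tensor"
  is "(-)" by (rule span_diff)

lift_definition uminus_sym_tensor :: "('a, 'b) sym_tensor \<Rightarrow> ('a, 'b) sym_tensor"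
  is uminus by (rule span_neg)

lift_definition scaleR_sym_tensor :: "real \<Rightarrow> ('a, 'b) sym_tensor \<Rightarrow> ('a, 'b) sym_tensor"
  is "(*\<^sub>R)" by (rule span_scale)

instance
  by standard (transfer, simp add: algebra_simps)+

end

lift_definition sym_power :: "'a::real_vector \<Rightarrow> ('k, 'a) sym_tensor" is tensor_power
  by (simp add: span_base)

lemma linear_Rep_sym_tensor: "linear Rep_sym_tensor"
  by (rule linearI) (simp_all add: plus_sym_tensor.rep_eq scaleR_sym_tensor.rep_eq)

lemma sym_tensor_representation:
  obtains r :: nat and c x where "v = (\<Sum>j<r. c j *\<^sub>R sym_power (x j))"
proof -
  obtain S u where S: "finite S" "S \<subseteq> range tensor_power" "Rep_sym_tensor v = (\<Sum>a\<in>S. u a *\<^sub>R a)"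
    using Rep_sym_tensor[of v] unfolding span_explicit by blast
  obtain h where h: "bij_betw h {..<card S} S"
    using ex_bij_betw_nat_finite[OF S(1)] by (auto simp: atLeast0LessThan)
  have "\<forall>j<card S. \<exists>y. h j = tensor_power y" using h S(2) by (auto simp: bij_betw_def)
  then obtain x where x: "\<And>j. j < card S \<Longrightarrow> h j = tensor_power (x j)" by metis
  have "Rep_sym_tensor v = (\<Sum>j<card S. u (h j) *\<^sub>R h j)"
    unfolding S(3) using sum.reindex_bij_betw[OF h, of "\<lambda>a. u a *\<^sub>R a"] by simp
  also have "\<dots> = Rep_sym_tensor (\<Sum>j<card S. u (h j) *\<^sub>R sym_power (x j))"
    by (simp add: linear_sum[OF linear_Rep_sym_tensor] scaleR_sym_tensor.rep_eq sym_power.rep_eq x)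
  finally show ?thesis using that by (simp add: Rep_sym_tensor_inject)
qed

lemma span_sym_power: "span (range sym_power) = (UNIV :: ('k, 'a::real_vector) sym_tensor set)"
proof -
  have "v \<in> span (range sym_power)" for v :: "('k, 'a) sym_tensor"
  proof -
    obtain r c x where "v = (\<Sum>j<(r::nat). c j *\<^sub>R sym_power (x j))"
      by (rule sym_tensor_representation)
    then show ?thesis by (simp add: span_sum span_scale span_base)
  qed
  then show ?thesis by blast
qed

lemma multilinear_prod:
  fixes \<psi> :: "'k::finite \<Rightarrow> 'a::real_vector \<Rightarrow> real"
  assumes "\<And>i. linear (\<psi> i)"
  shows "multilinear (\<lambda>v. \<Prod>i\<in>UNIV. \<psi> i (v i))"
  unfolding multilinear_def
proof (intro allI)
  fix v and i :: 'k
  have eq: "(\<Prod>j\<in>UNIV. \<psi> j ((v(i := x)) j)) = \<psi> i x * (\<Prod>j\<in>UNIV - {i}. \<psi> j (v j))" for x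
    by (subst prod.remove[of UNIV i]) (auto intro!: prod.cong)
  show "linear (\<lambda>x. \<Prod>j\<in>UNIV. \<psi> j ((v(i := x)) j))"
    unfolding eq using assms[of i] by (intro linearI) (simp_all add: linear_add linear_scale algebra_simps)
qed

text \<open>
  The functional \<open>\<otimes>\<^sup>k x \<mapsto> \<phi>(x)\<^sup>k\<close>; an auxiliary notion for working with the injective norm.
\<close>

definition power_pairing :: "('a::real_normed_vector \<Rightarrow>\<^sub>L real) \<Rightarrow> ('k::finite, 'a) sym_tensor \<Rightarrow> real" where
  "power_pairing \<phi> v = Rep_tensor (Rep_sym_tensor v) (\<lambda>u. \<Prod>i\<in>UNIV. \<phi> (u i))"

lemma linear_power_pairing: "linear (power_pairing \<phi>)"
  by (rule linearI)
    (simp_all add: power_pairing_def plus_sym_tensor.rep_eq scaleR_sym_tensor.rep_eq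
      plus_tensor.rep_eq scaleR_tensor.rep_eq)

lemma power_pairing_power [simp]: "power_pairing \<phi> (sym_power x :: ('k::finite, 'a::real_normed_vector) sym_tensor) = \<phi> x ^ CARD('k)"
proof -
  have "multilinear (\<lambda>u::'k \<Rightarrow> 'a. \<Prod>i\<in>UNIV. \<phi> (u i))"
    by (rule multilinear_prod) (simp add: bounded_linear.linear blinfun.bounded_linear_right)
  then show ?thesis by (simp add: power_pairing_def sym_power.rep_eq tensor_power_def tensor.rep_eq)
qed

lemma power_pairing_sum:
  "power_pairing \<phi> (\<Sum>j<r. c j *\<^sub>R sym_power (x j) :: ('k::finite, 'a::real_normed_vector) sym_tensor)
     = (\<Sum>j<r. c j * blinfun_apply \<phi> (x j) ^ CARD('k))"
  by (simp add: linear_sum[OF linear_power_pairing] linear_scale[OF linear_power_pairing])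

lemma power_pairing_scale:
  "power_pairing (d *\<^sub>R \<phi>) (v :: ('k::finite, 'a::real_normed_vector) sym_tensor) = d ^ CARD('k) * power_pairing \<phi> v"
proof -
  obtain r c x where v: "v = (\<Sum>j<(r::nat). c j *\<^sub>R sym_power (x j))"
    by (rule sym_tensor_representation)
  show ?thesis unfolding v power_pairing_sum
    by (simp add: blinfun.scaleR_left power_mult_distrib sum_distrib_left mult_ac)
qed

text \<open>
  The next facts show that the symmetric injective seminorm is definite.
\<close>

lemma power_sums_zero_imp_product_sums_zero:
  fixes x :: "nat \<Rightarrow> 'a::real_normed_vector"
  assumes *: "\<And>\<phi> :: 'a \<Rightarrow>\<^sub>L real. (\<Sum>j<r. c j * blinfun_apply \<phi> (x j) ^ k) = 0"
    and "finite T" "card T \<le> k"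
  shows "(\<Sum>j<r. c j * (\<Prod>i\<in>T. blinfun_apply (\<psi> i) (x j)) * blinfun_apply \<phi> (x j) ^ (k - card T)) = 0"
  using \<open>finite T\<close> \<open>card T \<le> k\<close>
proof (induction T arbitrary: \<phi> rule: finite_induct)
  case empty
  then show ?case using * by simp
next
  case (insert s T)
  define m where "m = k - card T"
  have m: "m > 0" "k - card (insert s T) = m - 1" using insert by (auto simp: m_def)
  define R where "R j = c j * (\<Prod>i\<in>T. blinfun_apply (\<psi> i) (x j))" for j
  define F where "F t = (\<Sum>j<r. R j * (\<phi> (x j) + t * \<psi> s (x j)) ^ m)" for t :: real
  have "F t = 0" for t
    using insert.IH[of "\<phi> + t *\<^sub>R \<psi> s"] insert.prems insert.hyps
    by (simp add: F_def R_def m_def blinfun.add_left blinfun.scaleR_left)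
  then have "F = (\<lambda>t. 0)" by blast
  then have "(F has_real_derivative 0) (at 0)" by simp
  moreover have "(F has_real_derivative (\<Sum>j<r. R j * (real m * (\<phi> (x j)) ^ (m - 1) * \<psi> s (x j)))) (at 0)"
    unfolding F_def by (auto intro!: derivative_eq_intros sum.cong simp: mult_ac)
  ultimately have "(\<Sum>j<r. R j * (real m * (\<phi> (x j)) ^ (m - 1) * \<psi> s (x j))) = 0"
    using DERIV_unique by blast
  then have "real m * (\<Sum>j<r. R j * \<psi> s (x j) * (\<phi> (x j)) ^ (m - 1)) = 0"
    by (simp add: sum_distrib_left mult_ac)
  then have "(\<Sum>j<r. R j * \<psi> s (x j) * (\<phi> (x j)) ^ (m - 1)) = 0" using m by simp
  then show ?case unfolding m(2) using insert.hyps by (simp add: R_def mult_ac)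
qed

lemma biorthogonal_functionals:
  fixes B :: "'a::real_normed_vector set"
  assumes "finite B" "independent B"
  obtains \<phi> :: "'a \<Rightarrow> 'a \<Rightarrow>\<^sub>L real"
  where "\<And>b c. b \<in> B \<Longrightarrow> c \<in> B \<Longrightarrow> \<phi> b c = (if b = c then 1 else 0)"
proof -
  have "\<exists>\<phi> :: 'a \<Rightarrow> 'a \<Rightarrow>\<^sub>L real. \<forall>b\<in>B. \<forall>c\<in>B. \<phi> b c = (if b = c then 1 else 0)"
    using assms
  proof (induction B rule: finite_induct)
    case empty
    then show ?case by simp
  next
    case (insert a B)
    then have "independent B" and a: "a \<notin> span B"
      by (auto simp: independent_insert)
    with insert obtain \<phi> :: "'a \<Rightarrow> 'a \<Rightarrow>\<^sub>L real"
      where \<phi>: "\<And>b c. b \<in> B \<Longrightarrow> c \<in> B \<Longrightarrow> \<phi> b c = (if b = c then 1 else 0)" by blast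
    define a' where "a' = a - (\<Sum>b\<in>B. \<phi> b a *\<^sub>R b)"
    have "a' \<noteq> 0"
    proof
      assume "a' = 0"
      then have "a = (\<Sum>b\<in>B. \<phi> b a *\<^sub>R b)" by (simp add: a'_def)
      also have "\<dots> \<in> span B" by (intro span_sum span_scale span_base)
      finally show False using a by simp
    qed
    obtain f :: "'a \<Rightarrow>\<^sub>L real" where f: "f a' = norm a'" by (rule hahn_banach_norming)
    define \<psi> where "\<psi> = (1 / norm a') *\<^sub>R f"
    have \<psi>: "\<psi> a' = 1" using f \<open>a' \<noteq> 0\<close> by (simp add: \<psi>_def blinfun.scaleR_left)
    define g where "g = \<psi> - (\<Sum>b\<in>B. \<psi> b *\<^sub>R \<phi> b)"
    have gc: "g c = 0" if "c \<in> B" for c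
    proof -
      have "(\<Sum>b\<in>B. \<psi> b * \<phi> b c) = (\<Sum>b\<in>B. if b = c then \<psi> b else 0)"
        by (rule sum.cong) (simp_all add: \<phi> that)
      then show ?thesis using that insert.hyps
        by (simp add: g_def blinfun.diff_left blinfun.sum_left blinfun.scaleR_left)
    qed
    have ga: "g a = 1"
      using \<psi> by (simp add: g_def a'_def blinfun.diff_left blinfun.sum_left blinfun.scaleR_left
          blinfun.diff_right blinfun.sum_right blinfun.scaleR_right mult.commute)
    define \<phi>' where "\<phi>' b = (if b = a then g else \<phi> b - \<phi> b a *\<^sub>R g)" for b
    have "\<forall>b\<in>insert a B. \<forall>c\<in>insert a B. \<phi>' b c = (if b = c then 1 else 0)"
      using gc ga \<phi> insert.hyps by (auto simp: \<phi>'_def blinfun.diff_left blinfun.scaleR_left)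
    then show ?case by blast
  qed
  then show ?thesis using that by blast
qed

lemma power_pairing_zero_imp:
  fixes v :: "('k::finite, 'a::real_normed_vector) sym_tensor"
  assumes "\<And>\<phi>. power_pairing \<phi> v = 0"
  shows "v = 0"
proof -
  obtain r c x where v: "v = (\<Sum>j<(r::nat). c j *\<^sub>R sym_power (x j))"
    by (rule sym_tensor_representation)
  obtain B where B: "B \<subseteq> x ` {..<r}" "independent B" "x ` {..<r} \<subseteq> span B"
    by (rule maximal_independent_subset)
  have finB: "finite B" using finite_subset[OF B(1)] by simp
  then obtain \<beta> :: "'a \<Rightarrow> 'a \<Rightarrow>\<^sub>L real"
    where \<beta>: "\<And>b c. b \<in> B \<Longrightarrow> c \<in> B \<Longrightarrow> \<beta> b c = (if b = c then 1 else 0)"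
    using biorthogonal_functionals B(2) by blast
  have expand: "x j = (\<Sum>b\<in>B. \<beta> b (x j) *\<^sub>R b)" if "j < r" for j
  proof -
    have lin: "linear (\<lambda>y. \<Sum>b\<in>B. \<beta> b y *\<^sub>R b)"
      by (rule linearI) (simp_all add: blinfun.add_right blinfun.scaleR_right scaleR_add_left
          sum.distrib scaleR_sum_right)
    have "y = (\<Sum>b\<in>B. \<beta> b y *\<^sub>R b)" if y: "y \<in> B" for y
    proof -
      have "(\<Sum>b\<in>B. \<beta> b y *\<^sub>R b) = (\<Sum>b\<in>B. if b = y then b else 0)"
        by (rule sum.cong) (simp_all add: \<beta> y)
      then show ?thesis using finB y by simp
    qed
    moreover have "x j \<in> span B" using B(3) that by blast
    ultimately show ?thesis using linear_eq_on_span[OF linear_id lin, of B "x j"] by simp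
  qed
  have powers: "(\<Sum>j<r. c j * blinfun_apply \<phi> (x j) ^ CARD('k)) = 0" for \<phi> :: "'a \<Rightarrow>\<^sub>L real"
    using assms[of \<phi>] unfolding v power_pairing_sum .
  have prods: "(\<Sum>j<r. c j * (\<Prod>i\<in>(UNIV::'k set). blinfun_apply (\<psi> i) (x j))) = 0" for \<psi> :: "'k \<Rightarrow> 'a \<Rightarrow>\<^sub>L real"
    using power_sums_zero_imp_product_sums_zero[where r=r and c=c and x=x and k="CARD('k)"
        and T="UNIV::'k set" and \<psi>=\<psi> and \<phi>=0, OF powers] by simp
  have "(\<Sum>j<r. c j * (\<Prod>i\<in>-S. blinfun_apply (\<psi> i) (x j)) * A (\<lambda>i. if i \<in> S then x j else w i)) = 0"
    if A: "multilinear A" for A :: "('k \<Rightarrow> 'a) \<Rightarrow> real" and S \<psi> w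
    using finite[of S]
  proof (induction S arbitrary: \<psi> w rule: finite_induct)
    case empty
    have "(\<Sum>j<r. c j * (\<Prod>i\<in>UNIV. blinfun_apply (\<psi> i) (x j))) * A w = 0"
      by (simp only: prods mult_zero_left)
    then show ?case by (simp add: sum_distrib_right)
  next
    case (insert s S)
    define P where "P j = (\<Prod>i\<in>-insert s S. blinfun_apply (\<psi> i) (x j))" for j
    define V where "V j b = (\<lambda>i. if i \<in> S then x j else (w(s := b)) i)" for j b
    have A_exp: "A (\<lambda>i. if i \<in> insert s S then x j else w i) = (\<Sum>b\<in>B. \<beta> b (x j) * A (V j b))"
      if "j < r" for j
    proof -
      have lin: "linear (\<lambda>y. A ((V j 0)(s := y)))" using A by (simp add: multilinear_def)
      have V: "(V j 0)(s := y) = V j y" for y using insert.hyps by (auto simp: V_def fun_eq_iff)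
      have scale: "A (V j (d *\<^sub>R b)) = d * A (V j b)" for d b
        using linear_scale[OF lin, of d b] by (simp add: V)
      have "(\<lambda>i. if i \<in> insert s S then x j else w i) = (V j 0)(s := x j)"
        using insert.hyps by (auto simp: V_def fun_eq_iff)
      then have "A (\<lambda>i. if i \<in> insert s S then x j else w i) = A ((V j 0)(s := (\<Sum>b\<in>B. \<beta> b (x j) *\<^sub>R b)))"
        using expand[OF that] by simp
      also have "\<dots> = (\<Sum>b\<in>B. \<beta> b (x j) * A (V j b))"
        unfolding linear_sum[OF lin] by (simp add: V scale)
      finally show ?thesis .
    qed
    have split: "(\<Prod>i\<in>-S. blinfun_apply ((\<psi>(s := \<beta> b)) i) (x j)) = \<beta> b (x j) * P j" for b j
    proof -
      have "- S = insert s (- insert s S)" using insert.hyps by auto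
      then show ?thesis by (simp add: P_def)
    qed
    have "(\<Sum>j<r. c j * P j * A (\<lambda>i. if i \<in> insert s S then x j else w i))
        = (\<Sum>j<r. \<Sum>b\<in>B. c j * (\<beta> b (x j) * P j) * A (V j b))"
    proof (rule sum.cong[OF refl])
      fix j assume "j \<in> {..<r}"
      then have "j < r" by simp
      show "c j * P j * A (\<lambda>i. if i \<in> insert s S then x j else w i)
          = (\<Sum>b\<in>B. c j * (\<beta> b (x j) * P j) * A (V j b))"
        unfolding A_exp[OF \<open>j < r\<close>] by (simp add: sum_distrib_left mult_ac)
    qed
    also have "\<dots> = (\<Sum>b\<in>B. \<Sum>j<r. c j * (\<beta> b (x j) * P j) * A (V j b))" by (rule sum.swap)
    also have "\<dots> = 0"
      using insert.IH[of "\<psi>(s := \<beta> _)" "w(s := _)"] unfolding split V_def by simp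
    finally show ?case by (simp add: P_def)
  qed
  note vanish = this
  have "(\<Sum>j<r. c j * A (\<lambda>i. x j)) = 0" if "multilinear A" for A :: "('k \<Rightarrow> 'a) \<Rightarrow> real"
    using vanish[where S=UNIV and \<psi>="\<lambda>_. 0" and w="\<lambda>_. 0", OF that] by simp
  then have "Rep_tensor (Rep_sym_tensor v) A = Rep_tensor 0 A" for A
    by (cases "multilinear A") (simp_all add: v linear_sum[OF linear_Rep_sym_tensor] scaleR_sym_tensor.rep_eq sym_power.rep_eq
        Rep_tensor_sum scaleR_tensor.rep_eq tensor_power_def tensor.rep_eq zero_tensor.rep_eq)
  then have "Rep_sym_tensor v = 0" by (simp add: Rep_tensor_inject[symmetric] fun_eq_iff)
  then show ?thesis by (simp add: Rep_sym_tensor_inject[symmetric] zero_sym_tensor.rep_eq)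
qed

instantiation sym_tensor :: (finite, real_normed_vector) real_normed_vector
begin

text \<open>
  The symmetric injective norm. It is independent of the representation, see \<open>norm_sym_tensor\<close> below.
\<close>

definition norm_sym_tensor :: "('a, 'b) sym_tensor \<Rightarrow> real" where
  "norm_sym_tensor v = (THE s. \<exists>(r::nat) c x. v = (\<Sum>j<r. c j *\<^sub>R sym_power (x j)) \<and>
     s = (SUP \<phi>\<in>{\<phi> :: 'b \<Rightarrow>\<^sub>L real. norm \<phi> \<le> 1}. \<bar>\<Sum>j<r. c j * blinfun_apply \<phi> (x j) ^ CARD('a)\<bar>))"

definition dist_sym_tensor :: "('a, 'b) sym_tensor \<Rightarrow> ('a, 'b) sym_tensor \<Rightarrow> real" where
  "dist_sym_tensor u v = norm (u - v)"

definition sgn_sym_tensor :: "('a, 'b) sym_tensor \<Rightarrow> ('a, 'b) sym_tensor" where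
  "sgn_sym_tensor v = v /\<^sub>R norm v"

definition uniformity_sym_tensor :: "(('a, 'b) sym_tensor \<times> ('a, 'b) sym_tensor) filter" where
  "uniformity_sym_tensor = (INF e\<in>{0<..}. principal {(u, v). dist u v < e})"

definition open_sym_tensor :: "('a, 'b) sym_tensor set \<Rightarrow> bool" where
  "open_sym_tensor U = (\<forall>u\<in>U. \<forall>\<^sub>F (u', v) in uniformity. u' = u \<longrightarrow> v \<in> U)"

lemma norm_sym_tensor_pairing:
  "norm (v :: ('a, 'b) sym_tensor) = (SUP \<phi>\<in>{\<phi> :: 'b \<Rightarrow>\<^sub>L real. norm \<phi> \<le> 1}. \<bar>power_pairing \<phi> v\<bar>)"
proof -
  obtain r c x where "v = (\<Sum>j<(r::nat). c j *\<^sub>R sym_power (x j))"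
    by (rule sym_tensor_representation)
  then show ?thesis unfolding norm_sym_tensor_def
    by (intro the_equality exI conjI)
      (assumption, simp add: power_pairing_sum, elim exE conjE, simp flip: power_pairing_sum)
qed

lemma bdd_above_power_pairing:
  "bdd_above ((\<lambda>\<phi>. \<bar>power_pairing \<phi> (v :: ('a, 'b) sym_tensor)\<bar>) ` {\<phi>. norm \<phi> \<le> 1})"
proof -
  obtain r c x where v: "v = (\<Sum>j<(r::nat). c j *\<^sub>R sym_power (x j))"
    by (rule sym_tensor_representation)
  have "\<bar>power_pairing \<phi> v\<bar> \<le> (\<Sum>j<r. \<bar>c j\<bar> * norm (x j) ^ CARD('a))" if "norm \<phi> \<le> 1" for \<phi>
  proof -
    have "\<bar>\<phi> (x j)\<bar> \<le> norm (x j)" for j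
      using norm_blinfun[of \<phi> "x j"] that
      by (metis mult_left_le_one_le norm_ge_zero order_trans real_norm_def)
    then have "\<bar>c j * blinfun_apply \<phi> (x j) ^ CARD('a)\<bar> \<le> \<bar>c j\<bar> * norm (x j) ^ CARD('a)" for j
      by (simp add: abs_mult power_abs mult_left_mono power_mono)
    then show ?thesis unfolding v power_pairing_sum
      by (intro order_trans[OF sum_abs] sum_mono) auto
  qed
  then show ?thesis by (auto intro!: bdd_aboveI2)
qed

lemma power_pairing_le_norm: "norm \<phi> \<le> 1 \<Longrightarrow> \<bar>power_pairing \<phi> v\<bar> \<le> norm (v :: ('a, 'b) sym_tensor)"
  unfolding norm_sym_tensor_pairing by (rule cSUP_upper[OF _ bdd_above_power_pairing]) simp

lemma norm_sym_tensor_le: "(\<And>\<phi>. norm \<phi> \<le> 1 \<Longrightarrow> \<bar>power_pairing \<phi> v\<bar> \<le> c) \<Longrightarrow> norm (v :: ('a, 'b) sym_tensor) \<le> c"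
  unfolding norm_sym_tensor_pairing by (rule cSUP_least) (auto intro: exI[of _ 0])

instance
proof
  fix u v :: "('a, 'b) sym_tensor" and c :: real
  have nonneg: "0 \<le> norm w" for w :: "('a, 'b) sym_tensor"
    using power_pairing_le_norm[of 0 w] by simp
  show "norm (u + v) \<le> norm u + norm v"
  proof (rule norm_sym_tensor_le)
    fix \<phi> :: "'b \<Rightarrow>\<^sub>L real" assume "norm \<phi> \<le> 1"
    then show "\<bar>power_pairing \<phi> (u + v)\<bar> \<le> norm u + norm v"
      using power_pairing_le_norm[of \<phi> u] power_pairing_le_norm[of \<phi> v]
      by (simp add: linear_add[OF linear_power_pairing])
  qed
  have le: "norm (d *\<^sub>R w) \<le> \<bar>d\<bar> * norm w" for d and w :: "('a, 'b) sym_tensor"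
    by (rule norm_sym_tensor_le)
      (simp add: linear_scale[OF linear_power_pairing] abs_mult power_pairing_le_norm mult_left_mono)
  show "norm (c *\<^sub>R v) = \<bar>c\<bar> * norm v"
  proof (cases "c = 0")
    case True
    then show ?thesis using le[of c v] nonneg[of "c *\<^sub>R v"] by simp
  next
    case False
    have "\<bar>c\<bar> * norm v \<le> \<bar>c\<bar> * (\<bar>1 / c\<bar> * norm (c *\<^sub>R v))"
      using le[of "1 / c" "c *\<^sub>R v"] False by (intro mult_left_mono) auto
    then show ?thesis using le[of c v] False by simp
  qed
  show "norm v = 0 \<longleftrightarrow> v = 0"
  proof
    assume v0: "norm v = 0"
    have "power_pairing \<phi> v = 0" for \<phi>
    proof (cases "\<phi> = 0")
      case True
      then show ?thesis using power_pairing_le_norm[of 0 v] v0 by simp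
    next
      case False
      then have "power_pairing ((1 / norm \<phi>) *\<^sub>R \<phi>) v = 0"
        using power_pairing_le_norm[of "(1 / norm \<phi>) *\<^sub>R \<phi>" v] v0 by simp
      then show ?thesis using False by (simp add: power_pairing_scale)
    qed
    then show "v = 0" by (rule power_pairing_zero_imp)
  next
    assume "v = 0"
    then show "norm v = 0" using le[of 0 v] nonneg[of v] by simp
  qed
qed (auto simp: dist_sym_tensor_def sgn_sym_tensor_def uniformity_sym_tensor_def open_sym_tensor_def)

end

lemma norm_sym_tensor:
  "norm (\<Sum>j<r. c j *\<^sub>R sym_power (x j) :: ('k::finite, 'a::real_normed_vector) sym_tensor)
     = (SUP \<phi>\<in>{\<phi> :: 'a \<Rightarrow>\<^sub>L real. norm \<phi> \<le> 1}. \<bar>\<Sum>j<r. c j * blinfun_apply \<phi> (x j) ^ CARD('k)\<bar>)"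
  by (simp add: norm_sym_tensor_pairing power_pairing_sum)

subsection \<open>Completions and induced maps\<close>

lift_definition bidual_embedding :: "'a::real_normed_vector \<Rightarrow> ('a \<Rightarrow>\<^sub>L real) \<Rightarrow>\<^sub>L real"
  is "\<lambda>x f. blinfun_apply f x"
  by (rule blinfun.bounded_linear_left)

lemma norm_bidual_embedding: "norm (bidual_embedding x) = norm x"
proof (rule antisym)
  show "norm (bidual_embedding x) \<le> norm x"
  proof (rule norm_blinfun_bound)
    show "norm (blinfun_apply (bidual_embedding x) f) \<le> norm x * norm f" for f
      using norm_blinfun[of f x] by (simp add: bidual_embedding.rep_eq mult.commute)
  qed simp
  obtain f :: "'a \<Rightarrow>\<^sub>L real" where f: "norm f \<le> 1" "f x = norm x" by (rule hahn_banach_norming)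
  have "norm x \<le> norm (bidual_embedding x) * norm f"
    using norm_blinfun[of "bidual_embedding x" f] f(2) by (simp add: bidual_embedding.rep_eq)
  also have "\<dots> \<le> norm (bidual_embedding x)" using f(1) by (simp add: mult_left_le)
  finally show "norm x \<le> norm (bidual_embedding x)" .
qed

lemma linear_bidual_embedding: "linear bidual_embedding"
  by (rule linearI; rule blinfun_eqI)
    (simp_all add: bidual_embedding.rep_eq blinfun.add_left blinfun.scaleR_left
      blinfun.add_right blinfun.scaleR_right)

lemma subspace_closure:
  fixes S :: "'a::real_normed_vector set"
  assumes "subspace S" shows "subspace (closure S)"
  unfolding subspace_def
proof (intro conjI ballI allI)
  show "0 \<in> closure S" using assms closure_subset subspace_0 by blast
  show "x + y \<in> closure S" if "x \<in> closure S" "y \<in> closure S" for x y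
  proof -
    obtain f where "\<forall>n. f n \<in> S" "f \<longlonglongrightarrow> x"
      using \<open>x \<in> closure S\<close> by (auto simp: closure_sequential)
    moreover obtain g where "\<forall>n. g n \<in> S" "g \<longlonglongrightarrow> y"
      using \<open>y \<in> closure S\<close> by (auto simp: closure_sequential)
    ultimately show ?thesis unfolding closure_sequential using assms
      by (intro exI[of _ "\<lambda>n. f n + g n"]) (simp add: tendsto_add subspace_add)
  qed
  show "c *\<^sub>R x \<in> closure S" if "x \<in> closure S" for c x
  proof -
    obtain f where "\<forall>n. f n \<in> S" "f \<longlonglongrightarrow> x"
      using \<open>x \<in> closure S\<close> by (auto simp: closure_sequential)
    then show ?thesis unfolding closure_sequential using assms
      by (intro exI[of _ "\<lambda>n. c *\<^sub>R f n"]) (simp add: tendsto_scaleR subspace_scale)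
  qed
qed

text \<open>
  The completion, realised as the closure of the canonical image in the bidual. It is a Banach space
  with an isometric linear map \<open>to_completion\<close> of dense range.
\<close>

typedef (overloaded) 'a::real_normed_vector completion =
  "closure (range (bidual_embedding :: 'a \<Rightarrow> _))"
  by (rule exI) (rule subsetD[OF closure_subset rangeI])

setup_lifting type_definition_completion

lemma subspace_completion: "subspace (closure (range (bidual_embedding :: 'a::real_normed_vector \<Rightarrow> _)))"
  by (intro subspace_closure linear_subspace_image linear_bidual_embedding subspace_UNIV)

instantiation completion :: (real_normed_vector) real_normed_vector
begin

lift_definition zero_completion :: "'a completion" is 0
  by (rule subspace_0[OF subspace_completion])

lift_definition plus_completion :: "'a completion \<Rightarrow> 'a completion \<Rightarrow> 'a completion" is "(+)"
  by (rule subspace_add[OF subspace_completion])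

lift_definition minus_completion :: "'a completion \<Rightarrow> 'a completion \<Rightarrow> 'a completion" is "(-)"
  by (rule subspace_diff[OF subspace_completion])

lift_definition uminus_completion :: "'a completion \<Rightarrow> 'a completion" is uminus
  by (rule subspace_neg[OF subspace_completion])

lift_definition scaleR_completion :: "real \<Rightarrow> 'a completion \<Rightarrow> 'a completion" is "(*\<^sub>R)"
  by (rule subspace_scale[OF subspace_completion])

lift_definition norm_completion :: "'a completion \<Rightarrow> real" is norm .

definition dist_completion :: "'a completion \<Rightarrow> 'a completion \<Rightarrow> real" where
  "dist_completion x y = norm (x - y)"

definition sgn_completion :: "'a completion \<Rightarrow> 'a completion" where
  "sgn_completion x = scaleR (inverse (norm x)) x"

definition uniformity_completion :: "('a completion \<times> 'a completion) filter" where
  "uniformity_completion = (INF e\<in>{0<..}. principal {(x, y). dist x y < e})"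

definition open_completion :: "'a completion set \<Rightarrow> bool" where
  "open_completion U = (\<forall>x\<in>U. \<forall>\<^sub>F (x', y) in uniformity. x' = x \<longrightarrow> y \<in> U)"

instance
proof
  fix x y z :: "'a completion" and a b :: real
  show "x + y + z = x + (y + z)" by transfer (rule add.assoc)
  show "x + y = y + x" by transfer (rule add.commute)
  show "0 + x = x" by transfer simp
  show "- x + x = 0" by transfer simp
  show "x - y = x + - y" by transfer simp
  show "a *\<^sub>R (x + y) = a *\<^sub>R x + a *\<^sub>R y" by transfer (rule scaleR_add_right)
  show "(a + b) *\<^sub>R x = a *\<^sub>R x + b *\<^sub>R x" by transfer (rule scaleR_add_left)
  show "a *\<^sub>R b *\<^sub>R x = (a * b) *\<^sub>R x" by transfer simp
  show "1 *\<^sub>R x = x" by transfer simp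
  show "norm x = 0 \<longleftrightarrow> x = 0" by transfer simp
  show "norm (x + y) \<le> norm x + norm y" by transfer (rule norm_triangle_ineq)
  show "norm (a *\<^sub>R x) = \<bar>a\<bar> * norm x" by transfer simp
qed (simp_all add: dist_completion_def sgn_completion_def uniformity_completion_def open_completion_def)

end

lemma dist_Rep_completion: "dist (Rep_completion x) (Rep_completion y) = dist x y"
  by (simp add: dist_norm norm_completion.rep_eq minus_completion.rep_eq)

lemma tendsto_Rep_completion: "(f \<longlongrightarrow> x) F \<longleftrightarrow> ((\<lambda>n. Rep_completion (f n)) \<longlongrightarrow> Rep_completion x) F"
  by (simp add: tendsto_iff dist_Rep_completion)

instance completion :: (real_normed_vector) banach
proof
  fix X :: "nat \<Rightarrow> 'a completion" assume "Cauchy X"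
  then have "Cauchy (\<lambda>n. Rep_completion (X n))" by (simp add: Cauchy_def dist_Rep_completion)
  then obtain l where l: "(\<lambda>n. Rep_completion (X n)) \<longlonglongrightarrow> l"
    using Cauchy_convergent[of "\<lambda>n. Rep_completion (X n)"] by (auto simp: convergent_def)
  then have "l \<in> closure (range bidual_embedding)"
    by (rule closed_sequentially[OF closed_closure Rep_completion])
  then have "X \<longlonglongrightarrow> Abs_completion l"
    using l by (simp add: tendsto_Rep_completion Abs_completion_inverse)
  then show "convergent X" by (auto simp: convergent_def)
qed

lift_definition to_completion :: "'a::real_normed_vector \<Rightarrow> 'a completion" is bidual_embedding
  by (rule subsetD[OF closure_subset rangeI])

lemma norm_to_completion: "norm (to_completion x) = norm x"
  by (simp add: norm_completion.rep_eq to_completion.rep_eq norm_bidual_embedding)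

lemma bounded_linear_to_completion: "bounded_linear to_completion"
  by (rule bounded_linear_intro[where K=1])
    (simp_all add: norm_to_completion Rep_completion_inject[symmetric] to_completion.rep_eq
      plus_completion.rep_eq scaleR_completion.rep_eq
      linear_add[OF linear_bidual_embedding] linear_scale[OF linear_bidual_embedding])

lemma closure_range_to_completion: "closure (range to_completion) = UNIV"
proof -
  have "z \<in> closure (range to_completion)" for z :: "'a completion"
  proof -
    have "\<exists>f. (\<forall>n. f n \<in> range bidual_embedding) \<and> f \<longlonglongrightarrow> Rep_completion z"
      using Rep_completion[of z] by (simp only: closure_sequential)
    then obtain f
      where f': "(\<forall>n. f n \<in> range bidual_embedding) \<and> f \<longlonglongrightarrow> Rep_completion z" ..
    have f: "\<And>n. f n \<in> range bidual_embedding" "f \<longlonglongrightarrow> Rep_completion z"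
      by (rule conjunct1[OF f', rule_format], rule conjunct2[OF f'])
    define g where "g n = inv bidual_embedding (f n)" for n
    have "f = (\<lambda>n. bidual_embedding (g n))"
      unfolding g_def by (intro ext) (rule f_inv_into_f[OF f(1), symmetric])
    then have "(\<lambda>n. to_completion (g n)) \<longlonglongrightarrow> z"
      using f(2) by (simp add: tendsto_Rep_completion to_completion.rep_eq)
    then show ?thesis
      unfolding closure_sequential by (intro exI[of _ "\<lambda>n. to_completion (g n)"]) simp
  qed
  then show ?thesis by (simp add: set_eq_iff)
qed

text \<open>
  The extension of a bounded operator to the completions; existence is \<open>completion_map_to_completion\<close>.
\<close>

definition completion_map ::
    "('a::real_normed_vector \<Rightarrow>\<^sub>L 'b::real_normed_vector) \<Rightarrow> 'a completion \<Rightarrow>\<^sub>L 'b completion" where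
  "completion_map T = (THE J. \<forall>x. blinfun_apply J (to_completion x) = to_completion (T x))"

lemma completion_blinfun_eqI:
  fixes J J' :: "'a::real_normed_vector completion \<Rightarrow>\<^sub>L 'b::real_normed_vector"
  assumes "\<And>x. J (to_completion x) = J' (to_completion x)"
  shows "J = J'"
proof (rule blinfun_eqI)
  fix z :: "'a completion"
  have "closed {z. J z = J' z}" by (intro closed_Collect_eq continuous_intros)
  moreover have "range to_completion \<subseteq> {z. J z = J' z}" using assms by auto
  ultimately have "closure (range to_completion) \<subseteq> {z. J z = J' z}" by (rule closure_minimal[rotated])
  then show "J z = J' z" unfolding closure_range_to_completion by blast
qed

lemma completion_map_to_completion:
  fixes T :: "'a::real_normed_vector \<Rightarrow>\<^sub>L 'b::real_normed_vector"
  shows "completion_map T (to_completion x) = to_completion (T x)"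
proof -
  have bl: "bounded_linear (\<lambda>f. F (f o\<^sub>L T))" for F :: "('a \<Rightarrow>\<^sub>L real) \<Rightarrow>\<^sub>L real"
    by (intro bounded_linear_compose[OF blinfun.bounded_linear_right]
        bounded_bilinear.bounded_linear_left[OF bounded_bilinear_blinfun_compose])
  define D where "D F = Blinfun (\<lambda>f. blinfun_apply F (f o\<^sub>L T))" for F :: "('a \<Rightarrow>\<^sub>L real) \<Rightarrow>\<^sub>L real"
  have D: "D F f = F (f o\<^sub>L T)" for F f by (simp add: D_def bounded_linear_Blinfun_apply[OF bl])
  have blD: "bounded_linear D"
  proof (rule bounded_linear_intro[where K="norm T"])
    show "D (F + G) = D F + D G" "D (r *\<^sub>R F) = r *\<^sub>R D F" for F G r
      by (auto intro!: blinfun_eqI simp: D blinfun.add_left blinfun.scaleR_left)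
    show "norm (D F) \<le> norm F * norm T" for F
    proof (rule norm_blinfun_bound)
      fix f
      have "norm (D F f) \<le> norm F * norm (f o\<^sub>L T)" unfolding D by (rule norm_blinfun)
      also have "\<dots> \<le> norm F * (norm f * norm T)" by (intro mult_left_mono norm_blinfun_compose) simp
      finally show "norm (D F f) \<le> norm F * norm T * norm f" by (simp add: mult_ac)
    qed simp
  qed
  have Dbe: "D (bidual_embedding x) = bidual_embedding (T x)" for x
    by (rule blinfun_eqI) (simp add: D bidual_embedding.rep_eq)
  have "D ` closure (range bidual_embedding) \<subseteq> closure (range bidual_embedding)"
  proof (rule image_closure_subset)
    show "continuous_on (closure (range bidual_embedding)) D" by (rule linear_continuous_on[OF blD])
    show "D ` range bidual_embedding \<subseteq> closure (range bidual_embedding)"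
      using subsetD[OF closure_subset rangeI] by (auto simp: Dbe)
  qed simp
  then have mem: "D (Rep_completion z) \<in> closure (range bidual_embedding)" for z
    using Rep_completion by blast
  define J where "J z = Abs_completion (D (Rep_completion z))" for z
  have RJ: "Rep_completion (J z) = D (Rep_completion z)" for z
    by (simp add: J_def Abs_completion_inverse mem)
  obtain K where K: "\<And>F. norm (D F) \<le> norm F * K" using bounded_linear.bounded[OF blD] by blast
  have "bounded_linear J"
    by (rule bounded_linear_intro[where K=K])
      (simp_all add: Rep_completion_inject[symmetric] RJ plus_completion.rep_eq scaleR_completion.rep_eq
        norm_completion.rep_eq K linear_add linear_scale bounded_linear.linear[OF blD])
  moreover have "J (to_completion x) = to_completion (T x)" for x
    by (simp add: Rep_completion_inject[symmetric] RJ to_completion.rep_eq Dbe)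
  ultimately have "\<forall>x. Blinfun J (to_completion x) = to_completion (T x)"
    by (simp add: bounded_linear_Blinfun_apply)
  then have "\<exists>!J. \<forall>x. blinfun_apply J (to_completion x) = to_completion (T x)"
    by (intro ex1I[of _ "Blinfun J"]) (auto intro!: completion_blinfun_eqI)
  from theI'[OF this] show ?thesis unfolding completion_map_def by blast
qed

lemma norm_completion_map:
  assumes "\<And>x. norm (blinfun_apply T x) = norm x"
  shows "norm (completion_map T z) = norm z"
proof -
  have "closed {z. norm (completion_map T z) = norm z}" by (intro closed_Collect_eq continuous_intros)
  moreover have "range to_completion \<subseteq> {z. norm (completion_map T z) = norm z}"
    using assms by (auto simp: completion_map_to_completion norm_to_completion)
  ultimately have "closure (range to_completion) \<subseteq> {z. norm (completion_map T z) = norm z}"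
    by (rule closure_minimal[rotated])
  then show ?thesis unfolding closure_range_to_completion by blast
qed

text \<open>
  The operator \<open>\<otimes>\<^sup>k x \<mapsto> \<otimes>\<^sup>k T x\<close>; existence is \<open>sym_tensor_map_sym_power\<close>.
\<close>

definition sym_tensor_map ::
    "('a::real_normed_vector \<Rightarrow>\<^sub>L 'b::real_normed_vector) \<Rightarrow> ('k::finite, 'a) sym_tensor \<Rightarrow>\<^sub>L ('k, 'b) sym_tensor" where
  "sym_tensor_map T = (THE L. \<forall>x. blinfun_apply L (sym_power x) = sym_power (T x))"

lemma power_pairing_compose:
  fixes L :: "('k::finite, 'a::real_normed_vector) sym_tensor \<Rightarrow> ('k, 'b::real_normed_vector) sym_tensor"
  assumes "linear L" "\<And>x. L (sym_power x) = sym_power (blinfun_apply T x)"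
  shows "power_pairing \<phi> (L v) = power_pairing (\<phi> o\<^sub>L T) v"
proof -
  obtain r c x where v: "v = (\<Sum>j<(r::nat). c j *\<^sub>R sym_power (x j))"
    by (rule sym_tensor_representation)
  have "L v = (\<Sum>j<r. c j *\<^sub>R sym_power (T (x j)))"
    unfolding v by (simp add: linear_sum[OF assms(1)] linear_scale[OF assms(1)] assms(2))
  then have "power_pairing \<phi> (L v) = (\<Sum>j<r. c j * blinfun_apply \<phi> (T (x j)) ^ CARD('k))"
    by (simp only: power_pairing_sum)
  also have "\<dots> = power_pairing (\<phi> o\<^sub>L T) v"
    unfolding v power_pairing_sum by simp
  finally show ?thesis .
qed

lemma abs_power_pairing_le:
  "\<bar>power_pairing \<phi> v\<bar> \<le> norm \<phi> ^ CARD('k) * norm (v :: ('k::finite, 'a::real_normed_vector) sym_tensor)"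
proof (cases "\<phi> = 0")
  case True
  have "power_pairing 0 v = 0"
    using power_pairing_scale[of 0 0 v]
    by (simp only: scaleR_zero_left zero_power[OF zero_less_card_finite] mult_zero_left)
  then show ?thesis using True by simp
next
  case False
  have "power_pairing (norm \<phi> *\<^sub>R (1 / norm \<phi>) *\<^sub>R \<phi>) v = norm \<phi> ^ CARD('k) * power_pairing ((1 / norm \<phi>) *\<^sub>R \<phi>) v"
    by (rule power_pairing_scale)
  moreover have "\<bar>power_pairing ((1 / norm \<phi>) *\<^sub>R \<phi>) v\<bar> \<le> norm v"
    by (rule power_pairing_le_norm) (use False in simp)
  ultimately show ?thesis using False by (simp add: abs_mult mult_left_mono)
qed

lemma sym_tensor_map_sym_power:
  fixes T :: "'a::real_normed_vector \<Rightarrow>\<^sub>L 'b::real_normed_vector"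
  shows "sym_tensor_map T (sym_power x :: ('k::finite, 'a) sym_tensor) = sym_power (T x)"
proof -
  have linT: "linear (blinfun_apply T)" by (simp add: bounded_linear.linear blinfun.bounded_linear_right)
  have "multilinear (\<lambda>v :: 'k \<Rightarrow> 'a. tensor (\<lambda>i. T (v i)))"
    unfolding multilinear_def
  proof (intro allI)
    fix v :: "'k \<Rightarrow> 'a" and i
    have "linear (\<lambda>y. tensor ((\<lambda>i. T (v i))(i := y)))"
      by (rule multilinear_tensor[unfolded multilinear_def, rule_format])
    from linear_compose[OF linT this]
    show "linear (\<lambda>y. tensor (\<lambda>j. T ((v(i := y)) j)))"
      by (simp add: o_def fun_upd_def if_distrib[of "blinfun_apply T"] cong: if_cong)
  qed
  then obtain L where L: "linear L" "\<And>v :: 'k \<Rightarrow> 'a. L (tensor v) = tensor (\<lambda>i. T (v i))"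
    using tensor_universal by blast
  have "L ` span (range tensor_power) = span (L ` range tensor_power)"
    using linear_span_image[OF L(1)] by simp
  also have "\<dots> \<subseteq> span (range tensor_power)"
    by (rule span_mono) (auto simp: tensor_power_def L(2))
  finally have mem: "L (Rep_sym_tensor v) \<in> span (range tensor_power)" for v using Rep_sym_tensor by blast
  define M where "M v = Abs_sym_tensor (L (Rep_sym_tensor v))" for v
  have RM: "Rep_sym_tensor (M v) = L (Rep_sym_tensor v)" for v
    by (simp add: M_def Abs_sym_tensor_inverse mem)
  have linM: "linear M"
    by (rule linearI) (simp_all add: Rep_sym_tensor_inject[symmetric] RM plus_sym_tensor.rep_eq
        scaleR_sym_tensor.rep_eq linear_add[OF L(1)] linear_scale[OF L(1)])
  have M: "M (sym_power y) = sym_power (T y)" for y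
    by (simp add: Rep_sym_tensor_inject[symmetric] RM sym_power.rep_eq tensor_power_def L(2))
  have "norm (M v) \<le> norm v * norm T ^ CARD('k)" for v
  proof (rule norm_sym_tensor_le)
    fix \<phi> :: "'b \<Rightarrow>\<^sub>L real" assume \<phi>: "norm \<phi> \<le> 1"
    have "norm (\<phi> o\<^sub>L T) \<le> norm T"
      using norm_blinfun_compose[of \<phi> T] \<phi> by (meson mult_left_le_one_le norm_ge_zero order_trans)
    then have "norm (\<phi> o\<^sub>L T) ^ CARD('k) * norm v \<le> norm T ^ CARD('k) * norm v"
      by (intro mult_right_mono power_mono) auto
    then show "\<bar>power_pairing \<phi> (M v)\<bar> \<le> norm v * norm T ^ CARD('k)"
      unfolding power_pairing_compose[OF linM M]
      using abs_power_pairing_le[of "\<phi> o\<^sub>L T" v] by (simp add: mult.commute)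
  qed
  then have "bounded_linear M"
    by (intro bounded_linear_intro[where K="norm T ^ CARD('k)"]) (simp_all add: linear_add[OF linM] linear_scale[OF linM])
  then have ex: "\<forall>y. Blinfun M (sym_power y) = sym_power (T y)"
    by (simp add: bounded_linear_Blinfun_apply M)
  have uniq: "P = Q" if "\<forall>y. blinfun_apply P (sym_power y) = sym_power (T y)"
    "\<forall>y. blinfun_apply Q (sym_power y) = sym_power (T y)"
    for P Q :: "('k, 'a) sym_tensor \<Rightarrow>\<^sub>L ('k, 'b) sym_tensor"
  proof (rule blinfun_eqI)
    fix v :: "('k, 'a) sym_tensor"
    have "linear (blinfun_apply P)" "linear (blinfun_apply Q)"
      by (simp_all add: bounded_linear.linear blinfun.bounded_linear_right)
    moreover have "P w = Q w" if "w \<in> range sym_power" for w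
      using that \<open>\<forall>y. blinfun_apply P (sym_power y) = _\<close> \<open>\<forall>y. blinfun_apply Q (sym_power y) = _\<close> by auto
    moreover have "v \<in> span (range sym_power)" by (simp add: span_sym_power)
    ultimately show "P v = Q v" by (rule linear_eq_on_span)
  qed
  have "\<exists>!L :: ('k, 'a) sym_tensor \<Rightarrow>\<^sub>L ('k, 'b) sym_tensor.
      \<forall>y. blinfun_apply L (sym_power y) = sym_power (T y)"
    by (rule ex1I, rule ex, rule uniq[OF _ ex])
  from theI'[OF this] show ?thesis unfolding sym_tensor_map_def by blast
qed

lemma norm_sym_tensor_map:
  fixes T :: "'a::real_normed_vector \<Rightarrow>\<^sub>L 'b::real_normed_vector"
    and v :: "('k::finite, 'a) sym_tensor"
  assumes "\<And>x. norm (blinfun_apply T x) = norm x"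
  shows "norm (sym_tensor_map T v) = norm v"
proof (rule antisym)
  have pp: "power_pairing \<phi> (sym_tensor_map T v) = power_pairing (\<phi> o\<^sub>L T) v" for \<phi>
    by (rule power_pairing_compose)
      (simp_all add: sym_tensor_map_sym_power bounded_linear.linear blinfun.bounded_linear_right)
  show "norm (sym_tensor_map T v) \<le> norm v"
  proof (rule norm_sym_tensor_le)
    fix \<phi> :: "'b \<Rightarrow>\<^sub>L real" assume \<phi>: "norm \<phi> \<le> 1"
    have "norm (\<phi> o\<^sub>L T) \<le> 1"
    proof (rule norm_blinfun_bound)
      show "norm ((\<phi> o\<^sub>L T) x) \<le> 1 * norm x" for x
        using norm_blinfun[of \<phi> "T x"] \<phi> assms[of x] mult_right_mono[OF \<phi>, of "norm x"] by simp
    qed simp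
    then show "\<bar>power_pairing \<phi> (sym_tensor_map T v)\<bar> \<le> norm v"
      unfolding pp by (rule power_pairing_le_norm)
  qed
  show "norm v \<le> norm (sym_tensor_map T v)"
  proof (rule norm_sym_tensor_le)
    fix \<psi> :: "'a \<Rightarrow>\<^sub>L real" assume "norm \<psi> \<le> 1"
    then obtain f :: "'b \<Rightarrow>\<^sub>L real" where f: "norm f \<le> 1" "\<And>x. f (T x) = \<psi> x"
      using hahn_banach_extension[OF assms] by blast
    have "f o\<^sub>L T = \<psi>" by (rule blinfun_eqI) (simp add: f)
    then show "\<bar>power_pairing \<psi> v\<bar> \<le> norm (sym_tensor_map T v)"
      using power_pairing_le_norm[OF f(1), of "sym_tensor_map T v"] pp[of f] by simp
  qed
qed

type_synonym ('k, 'a) sym_inj_tensor = "('k, 'a) sym_tensor completion"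

definition sym_inj_tensor_map ::
    "('a::real_normed_vector \<Rightarrow>\<^sub>L 'b::real_normed_vector) \<Rightarrow> ('k::finite, 'a) sym_inj_tensor \<Rightarrow>\<^sub>L ('k, 'b) sym_inj_tensor" where
  "sym_inj_tensor_map T = completion_map (sym_tensor_map T)"

lemma norm_sym_inj_tensor_map:
  "(\<And>x. norm (blinfun_apply T x) = norm x) \<Longrightarrow> norm (sym_inj_tensor_map T z) = norm z"
  unfolding sym_inj_tensor_map_def by (intro norm_completion_map norm_sym_tensor_map)

lemma closed_range_isometry:
  fixes J :: "'a::banach \<Rightarrow>\<^sub>L 'b::real_normed_vector"
  assumes "\<And>x. norm (blinfun_apply J x) = norm x"
  shows "closed (range J)"
  using complete_isometric_image[of 1 UNIV "blinfun_apply J"] assms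
  by (simp add: complete_UNIV complete_imp_closed blinfun.bounded_linear_right)

lemma closed_range_sym_inj_tensor_map:
  fixes T :: "'a::real_normed_vector \<Rightarrow>\<^sub>L 'b::real_normed_vector"
  assumes "\<And>x. norm (blinfun_apply T x) = norm x"
  shows "closed (range (sym_inj_tensor_map T ::
    ('k::finite, 'a) sym_inj_tensor \<Rightarrow>\<^sub>L ('k, 'b) sym_inj_tensor))"
  by (rule closed_range_isometry) (rule norm_sym_inj_tensor_map[OF assms])

end

theory Submission
  imports Defs
begin

text \<open>
  The idea. If \<open>X\<close> is an \<open>M\<close>-ideal in \<open>Y\<close>, a functional \<open>G\<close> on \<open>Y\<close> whose restriction to
  \<open>X\<close> has the same norm as \<open>G\<close> lies in the complement of the annihilator of \<open>X\<close>. Hence, whenever \<open>H\<close> and \<open>G\<close> agree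
  on \<open>X\<close>, the norms add: \<open>\<parallel>H\<parallel> = \<parallel>G\<parallel> + \<parallel>H - G\<parallel>\<close> (\<open>M_ideal_norm_extension\<close>). The proof uses
  \<open>M\<close>-ideals only through this identity, once for \<open>X\<close> in \<open>Y\<close> and once for the tensor products.

  For \<open>X\<close> in \<open>Y\<close>: take a norm-one functional \<open>f\<close> vanishing on \<open>X\<close> and a norm-one functional \<open>g\<close>
  whose restriction to \<open>X\<close> still has norm one. Then there are almost norming vectors \<open>x \<in> X\<close> for \<open>g\<close>
  and \<open>y \<in> Y\<close> for \<open>f\<close> with \<open>\<parallel>x \<plusminus> y\<parallel> \<le> 1\<close> (\<open>M_ideal_l1_pair\<close>). The last condition says that
  \<open>\<bar>\<phi> y\<bar> + \<bar>\<phi> x\<bar> \<le> 1\<close> for all \<open>\<phi>\<close> in the dual unit ball, and it also forces \<open>g y\<close> to be almost \<open>0\<close>.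
  So \<open>(y, x)\<close> is almost biorthogonal to \<open>(f, g)\<close>.

  For the tensor products: let \<open>\<phi> = a f + b g\<close> with \<open>\<bar>a\<bar> + \<bar>b\<bar> \<le> 1\<close> and \<open>b \<noteq> 0\<close>, and let \<open>\<psi> = b g\<close>. The
  functionals \<open>\<phi>\<^sup>k\<close> and \<open>\<psi>\<^sup>k\<close> on the tensor product of \<open>Y\<close> agree on that of \<open>X\<close>, and \<open>\<psi>\<^sup>k\<close> has
  norm \<open>\<bar>b\<bar>\<^sup>k\<close> on both. If the norms add, then \<open>\<parallel>\<phi>\<^sup>k - \<psi>\<^sup>k\<parallel> \<le> 1 - \<bar>b\<bar>\<^sup>k\<close>. Test this
  difference on \<open>w = \<otimes>\<^sup>k(y + x) - \<otimes>\<^sup>ky - \<otimes>\<^sup>kx\<close>. Its norm is at most the maximum \<open>m\<close> of \<open>\<bar>p\<bar>\<close> on the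
  diamond \<open>\<bar>s\<bar> + \<bar>t\<bar> \<le> 1\<close>, where \<open>p s t = (s + t)\<^sup>k - s\<^sup>k - t\<^sup>k\<close>. In the limit \<open>\<psi>\<^sup>k\<close> takes the
  value \<open>p 0 b = 0\<close> at \<open>w\<close>, and \<open>\<phi>\<^sup>k\<close> takes the value \<open>p a b\<close>. With \<open>(a, b)\<close> a maximum point of \<open>\<bar>p\<bar>\<close>
  this gives \<open>m \<le> (1 - \<bar>b\<bar>\<^sup>k) m\<close>. As \<open>k > 1\<close>, \<open>p\<close> does not vanish identically, so \<open>m > 0\<close>; and
  \<open>b \<noteq> 0\<close> since \<open>p\<close> vanishes on the axes. This is a contradiction.
\<close>

section \<open>Functionals and distances to subspaces\<close>

lemma blinfun_eq_iff: "f = g \<longleftrightarrow> (\<forall>x. blinfun_apply f x = blinfun_apply g x)"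
  by (auto intro: blinfun_eqI)

lemma norm_blinfun_le_on_ball:
  fixes f :: "'a::real_normed_vector \<Rightarrow>\<^sub>L real"
  assumes "\<And>u. norm u \<le> 1 \<Longrightarrow> f u \<le> c"
  shows "norm f \<le> c"
proof (rule norm_blinfun_bound)
  show "0 \<le> c" using assms[of 0] by simp
  fix u
  show "norm (f u) \<le> c * norm u"
  proof (cases "u = 0")
    case False
    then have "f ((1 / norm u) *\<^sub>R u) \<le> c" "f ((- 1 / norm u) *\<^sub>R u) \<le> c"
      by (intro assms; simp)+
    then show ?thesis
      using False by (simp add: blinfun.scaleR_right blinfun.minus_right field_simps abs_le_iff)
  qed simp
qed

lemma almost_norming_vector:
  fixes f :: "'a::real_normed_vector \<Rightarrow>\<^sub>L real"
  assumes "c < norm f"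
  obtains u where "norm u \<le> 1" "c < f u"
  using norm_blinfun_le_on_ball[of f c] assms by (meson linorder_not_le)

lemma abs_blinfun_le_norm:
  fixes f :: "'a::real_normed_vector \<Rightarrow>\<^sub>L real"
  assumes "norm f \<le> 1"
  shows "\<bar>f x\<bar> \<le> norm x"
  using norm_blinfun[of f x] mult_right_mono[OF assms, of "norm x"] by simp

text \<open>
  First shrink \<open>p\<close> to a sublinear \<open>q\<close> that is linear along \<open>a\<close>; every functional below \<open>q\<close> then has
  the required value at \<open>a\<close>.
\<close>

lemma sublin_functional_attaining:
  fixes p :: "'a::real_normed_vector \<Rightarrow> real"
  assumes "sublin p"
  obtains f :: "'a \<Rightarrow>\<^sub>L real" where "\<And>x. f x \<le> p x" "p a \<le> f a"
proof -
  obtain q where q: "sublin q" "\<And>x. q x \<le> p x" "q (- a) \<le> - p a"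
    using sublin_reduce[OF assms] by blast
  obtain f :: "'a \<Rightarrow>\<^sub>L real" where f: "\<And>x. f x \<le> q x"
    using sublin_dominates_functional[OF q(1)] by blast
  have "f (- a) \<le> - p a" using f[of "- a"] q(3) by simp
  then show ?thesis using that[of f] f q(2) by (auto simp: blinfun.minus_right intro: order_trans)
qed

lemma sublin_quotient:
  fixes p :: "'a::real_normed_vector \<Rightarrow> real"
  assumes p: "sublin p" and nonneg: "\<And>x. 0 \<le> p x" and S: "subspace S"
  shows "sublin (\<lambda>y. INF s\<in>S. p (y - s))"
proof -
  define q where "q y = (INF s\<in>S. p (y - s))" for y
  have bdd: "bdd_below ((\<lambda>s. p (y - s)) ` S)" for y
    using nonneg by (auto intro!: bdd_belowI2)
  have ne: "S \<noteq> {}" using subspace_0[OF S] by blast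
  have qle: "q y \<le> p (y - s)" if "s \<in> S" for s y
    unfolding q_def by (rule cINF_lower[OF bdd that])
  have qge: "c \<le> q y" if "\<And>s. s \<in> S \<Longrightarrow> c \<le> p (y - s)" for c y
    unfolding q_def by (rule cINF_greatest[OF ne that])
  have add: "p (x + y) \<le> p x + p y" for x y using p by (simp add: sublin_def)
  have hom: "0 \<le> t \<Longrightarrow> p (t *\<^sub>R x) = t * p x" for t x using p by (simp add: sublin_def)
  have qp: "q y \<le> p y" for y using qle[OF subspace_0[OF S], of y] by simp
  have "q (y + z) \<le> q y + q z" for y z
  proof -
    have *: "q (y + z) \<le> p (y - s) + p (z - t)" if "s \<in> S" "t \<in> S" for s t
      using qle[OF subspace_add[OF S that], of "y + z"] add[of "y - s" "z - t"]
      by (simp add: algebra_simps)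
    have "q (y + z) - p (z - t) \<le> q y" if "t \<in> S" for t
      by (rule qge) (use *[OF _ that] in \<open>simp add: algebra_simps\<close>)
    then have "q (y + z) - q y \<le> q z" by (intro qge) (simp add: algebra_simps)
    then show ?thesis by simp
  qed
  moreover have "q (t *\<^sub>R y) = t * q y" if t: "0 \<le> t" for t y
  proof (cases "t = 0")
    case True
    have "q 0 = 0"
      using qp[of 0] sublin_zero[OF p] qge[of 0 0] nonneg by (metis order_antisym)
    then show ?thesis using True by simp
  next
    case False
    then have t: "0 < t" using t by simp
    have le: "r * q z \<le> q (r *\<^sub>R z)" if r: "0 < r" for r z
    proof (rule qge)
      fix s assume s: "s \<in> S"
      have "r * q z \<le> r * p (z - (1 / r) *\<^sub>R s)"
        using r s by (intro mult_left_mono qle subspace_scale[OF S]) auto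
      also have "\<dots> = p (r *\<^sub>R z - s)"
        using hom[of r "z - (1 / r) *\<^sub>R s"] r by (simp add: scaleR_diff_right)
      finally show "r * q z \<le> p (r *\<^sub>R z - s)" .
    qed
    have "(1 / t) * q (t *\<^sub>R y) \<le> q y" using le[of "1 / t" "t *\<^sub>R y"] t by simp
    then have "q (t *\<^sub>R y) \<le> t * q y" using t by (simp add: field_simps)
    then show ?thesis using le[OF t, of y] by simp
  qed
  moreover have "q y \<le> norm y" for y
    using qp[of y] p by (auto simp: sublin_def intro: order_trans)
  ultimately have "sublin q" unfolding sublin_def by blast
  then show ?thesis by (simp add: q_def[abs_def])
qed

text \<open>
  A functional dominated by the \<open>p\<close>-distance to \<open>S\<close> vanishes on \<open>S\<close>, because that distance is \<open>0\<close> there;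
  it is chosen to attain the distance at \<open>a\<close>. A seminorm \<open>p\<close> other than the norm is needed to
  put the maximum norm on a product space.
\<close>

lemma seminorm_distance_functional:
  fixes p :: "'a::real_normed_vector \<Rightarrow> real"
  assumes p: "sublin p" and nonneg: "\<And>x. 0 \<le> p x" and S: "subspace S"
    and d: "\<And>s. s \<in> S \<Longrightarrow> d \<le> p (a - s)"
  obtains f :: "'a \<Rightarrow>\<^sub>L real"
  where "\<And>x. f x \<le> p x" "\<And>s. s \<in> S \<Longrightarrow> f s = 0" "d \<le> f a"
proof -
  define q where "q y = (INF s\<in>S. p (y - s))" for y
  have "sublin q" using sublin_quotient[OF p nonneg S] by (simp add: q_def[abs_def])
  then obtain f :: "'a \<Rightarrow>\<^sub>L real" where f: "\<And>x. f x \<le> q x" "q a \<le> f a"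
    by (rule sublin_functional_attaining[where a=a]) blast
  have bdd: "bdd_below ((\<lambda>s. p (y - s)) ` S)" for y
    using nonneg by (auto intro!: bdd_belowI2)
  have qle: "q y \<le> p (y - s)" if "s \<in> S" for s y
    unfolding q_def by (rule cINF_lower[OF bdd that])
  have le0: "f s \<le> 0" if "s \<in> S" for s
    using f(1)[of s] qle[OF that, of s] sublin_zero[OF p] by simp
  show ?thesis
  proof
    show "f x \<le> p x" for x using f(1)[of x] qle[OF subspace_0[OF S], of x] by simp
    show "f s = 0" if "s \<in> S" for s
      using le0[OF that] le0[OF subspace_neg[OF S that]] by (simp add: blinfun.minus_right)
    have "d \<le> q a"
      unfolding q_def by (rule cINF_greatest) (use d subspace_0[OF S] in auto)
    then show "d \<le> f a" using f(2) by simp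
  qed
qed

lemma annihilating_functional:
  fixes i :: "'a::banach \<Rightarrow>\<^sub>L 'b::banach"
  assumes "closed (range i)" "range i \<noteq> UNIV"
  obtains f :: "'b \<Rightarrow>\<^sub>L real" where "norm f = 1" "\<And>x. f (i x) = 0"
proof -
  obtain a where a: "a \<notin> range i" using assms by blast
  have "open (- range i)" using assms(1) by (simp add: open_Compl)
  then obtain d where d: "d > 0" "\<And>y. dist y a < d \<Longrightarrow> y \<notin> range i"
    using a unfolding open_dist by (metis ComplD ComplI)
  have dd: "d \<le> norm (a - s)" if "s \<in> range i" for s
    using d(2)[of s] that by (fastforce simp: dist_norm norm_minus_commute)
  have S: "subspace (range i)"
    by (intro linear_subspace_image subspace_UNIV) (simp add: bounded_linear.linear blinfun.bounded_linear_right)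
  have n: "sublin (norm :: 'b \<Rightarrow> real)" by (auto simp: sublin_def norm_triangle_ineq)
  obtain h :: "'b \<Rightarrow>\<^sub>L real" where h: "\<And>s. s \<in> range i \<Longrightarrow> h s = 0" "d \<le> h a"
    using seminorm_distance_functional[OF n norm_ge_zero S dd] by metis
  have "h \<noteq> 0" using h(2) d(1) by auto
  then show ?thesis
    using that[of "(1 / norm h) *\<^sub>R h"] h(1) by (simp add: blinfun.scaleR_left)
qed

section \<open>Consequences of being an M-ideal\<close>

text \<open>
  Split \<open>G = u + v\<close> along the decomposition. Only \<open>v\<close> is seen on the subspace, so
  \<open>\<parallel>u\<parallel> + \<parallel>v\<parallel> = \<parallel>G\<parallel> \<le> \<parallel>v\<parallel>\<close> and \<open>u = 0\<close>. Thus \<open>H = (H - G) + G\<close> is the decomposition of \<open>H\<close>.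
\<close>

lemma M_ideal_norm_extension:
  fixes i :: "'a::banach \<Rightarrow>\<^sub>L 'b::banach" and G H :: "'b \<Rightarrow>\<^sub>L real"
  assumes iso: "\<And>x. norm (i x) = norm x" and M: "M_ideal (range i)"
    and G: "norm G \<le> norm (G o\<^sub>L i)" and GH: "H o\<^sub>L i = G o\<^sub>L i"
  shows "norm H = norm G + norm (H - G)"
proof -
  have ann: "f \<in> annihilator (range i) \<longleftrightarrow> f o\<^sub>L i = 0" for f :: "'b \<Rightarrow>\<^sub>L real"
    by (auto simp: annihilator_def blinfun_eq_iff)
  obtain X' where "l1_direct_sum (annihilator (range i)) X'"
    using M unfolding M_ideal_def by blast
  then have dec: "\<And>z. \<exists>u\<in>annihilator (range i). \<exists>v\<in>X'. z = u + v"
    and l1: "\<And>u v. u \<in> annihilator (range i) \<Longrightarrow> v \<in> X' \<Longrightarrow> norm (u + v) = norm u + norm v"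
    unfolding l1_direct_sum_def by blast+
  obtain u v where uv: "u \<in> annihilator (range i)" "v \<in> X'" "G = u + v"
    using dec by blast
  have "norm u + norm v = norm G" using l1 uv by simp
  also have "\<dots> \<le> norm (v o\<^sub>L i)"
  proof -
    have "G o\<^sub>L i = v o\<^sub>L i"
      using uv(1) by (simp add: uv(3) ann blinfun_eq_iff blinfun.add_left)
    then show ?thesis using G by simp
  qed
  also have "\<dots> \<le> norm v * 1"
    by (rule norm_blinfun_bound) (use norm_blinfun[of v "i _"] iso in auto)
  finally have "u = 0" by simp
  then have "G \<in> X'" using uv by simp
  moreover have "H - G \<in> annihilator (range i)"
    unfolding ann using GH by (simp add: blinfun_eq_iff blinfun.diff_left)
  ultimately show ?thesis using l1[of "H - G" G] by simp
qed

lemma norm_preserving_extension: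
  fixes i :: "'a::real_normed_vector \<Rightarrow>\<^sub>L 'b::real_normed_vector" and \<psi> :: "'a \<Rightarrow>\<^sub>L real"
  assumes iso: "\<And>x. norm (i x) = norm x"
  obtains g :: "'b \<Rightarrow>\<^sub>L real" where "norm g \<le> norm \<psi>" "g o\<^sub>L i = \<psi>"
proof (cases "\<psi> = 0")
  case True
  then show ?thesis using that[of 0] by (simp add: blinfun_eq_iff)
next
  case False
  then have "norm ((1 / norm \<psi>) *\<^sub>R \<psi>) \<le> 1" by simp
  then obtain f :: "'b \<Rightarrow>\<^sub>L real"
    where f: "norm f \<le> 1" "\<And>x. f (i x) = ((1 / norm \<psi>) *\<^sub>R \<psi>) x"
    using hahn_banach_extension[OF iso] by blast
  show ?thesis
  proof (rule that[of "norm \<psi> *\<^sub>R f"])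
    show "norm (norm \<psi> *\<^sub>R f) \<le> norm \<psi>" using f(1) by (simp add: mult_left_le)
    show "(norm \<psi> *\<^sub>R f) o\<^sub>L i = \<psi>"
      using False by (simp add: blinfun_eq_iff blinfun.scaleR_left f(2))
  qed
qed

text \<open>
  A form of the intersection property of balls that characterises \<open>M\<close>-ideals. The claim says that in
  \<open>Y \<times> Y\<close> with the maximum norm the point \<open>(x + y, x - y)\<close> has distance at most \<open>1\<close> to the antidiagonal
  \<open>{(z, -z) | z \<in> X}\<close>. A separating functional would be a pair \<open>\<phi>1, \<phi>2\<close> of functionals with
  \<open>\<parallel>\<phi>1\<parallel> + \<parallel>\<phi>2\<parallel> \<le> 1\<close> that agree on \<open>X\<close>, with a value above \<open>1\<close> at the point. Subtracting their common norm-preserving extension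
  \<open>\<gamma>\<close> and adding norms bounds this value by \<open>\<parallel>\<phi>1\<parallel> + \<parallel>\<phi>2\<parallel>\<close>: the contributions of
  \<open>\<gamma> y\<close> cancel.
\<close>

lemma M_ideal_symmetric_correction:
  fixes i :: "'a::banach \<Rightarrow>\<^sub>L 'b::banach"
  assumes iso: "\<And>x. norm (i x) = norm x" and M: "M_ideal (range i)"
    and x: "norm x \<le> 1" and y: "norm y \<le> 1" and c: "1 < c"
  obtains z where "norm (i x + (y - i z)) < c" "norm (i x - (y - i z)) < c"
proof (rule ccontr)
  assume "\<not> thesis"
  then have far: "c \<le> max (norm (i x + (y - i z))) (norm (i x - (y - i z)))" for z
    using that[of z] by (meson max.strict_boundedE linorder_not_le max_less_iff_conj)
  define p :: "'b \<times> 'b \<Rightarrow> real" where "p w = max (norm (fst w)) (norm (snd w))" for w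
  define S where "S = range (\<lambda>z. (i z, - i z))"
  \<comment> \<open>The norm of a product space is the Euclidean one, which dominates \<open>p\<close>.\<close>
  have "sublin p"
    unfolding sublin_def p_def
  proof (intro conjI allI impI)
    fix v w :: "'b \<times> 'b" and t :: real
    show "max (norm (fst (v + w))) (norm (snd (v + w)))
        \<le> max (norm (fst v)) (norm (snd v)) + max (norm (fst w)) (norm (snd w))"
      using norm_triangle_ineq[of "fst v" "fst w"] norm_triangle_ineq[of "snd v" "snd w"]
      by (auto simp: max_def)
    show "max (norm (fst (t *\<^sub>R v))) (norm (snd (t *\<^sub>R v))) = t * max (norm (fst v)) (norm (snd v))"
      if "0 \<le> t" using that by (simp add: max_mult_distrib_left)
    show "max (norm (fst v)) (norm (snd v)) \<le> norm v"
      using norm_fst_le[of "fst v" "snd v"] norm_snd_le[of "snd v" "fst v"] by simp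
  qed
  moreover have "0 \<le> p w" for w by (simp add: p_def le_max_iff_disj)
  moreover have "subspace S"
    unfolding S_def
    by (intro linear_subspace_image subspace_UNIV linearI)
      (simp_all add: blinfun.add_right blinfun.scaleR_right)
  moreover have "c \<le> p ((i x + y, i x - y) - s)" if "s \<in> S" for s
    using that far by (auto simp: S_def p_def algebra_simps)
  ultimately obtain F :: "('b \<times> 'b) \<Rightarrow>\<^sub>L real"
    where F: "\<And>w. F w \<le> p w" "\<And>s. s \<in> S \<Longrightarrow> F s = 0" "c \<le> F (i x + y, i x - y)"
    by (rule seminorm_distance_functional[where d=c and a="(i x + y, i x - y)"]) blast+
  have bl: "bounded_linear (\<lambda>u. F (u, 0))" "bounded_linear (\<lambda>u. F (0, u))"
    by (intro bounded_linear_compose[OF blinfun.bounded_linear_right] bounded_linear_Pair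
        bounded_linear_ident bounded_linear_zero)+
  define \<phi>1 where "\<phi>1 = Blinfun (\<lambda>u. F (u, 0))"
  define \<phi>2 where "\<phi>2 = Blinfun (\<lambda>u. F (0, u))"
  have app: "\<phi>1 u = F (u, 0)" "\<phi>2 u = F (0, u)" for u
    by (simp_all add: \<phi>1_def \<phi>2_def bounded_linear_Blinfun_apply bl)
  have split: "F (u, v) = \<phi>1 u + \<phi>2 v" for u v
    by (simp add: app flip: blinfun.add_right)
  have "\<phi>1 u + \<phi>2 v \<le> 1" if "norm u \<le> 1" "norm v \<le> 1" for u v
    using F(1)[of "(u, v)"] that by (simp add: split p_def)
  then have "norm \<phi>1 \<le> 1 - \<phi>2 v" if "norm v \<le> 1" for v
    using that by (intro norm_blinfun_le_on_ball) (simp add: le_diff_eq)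
  then have "norm \<phi>2 \<le> 1 - norm \<phi>1"
    by (intro norm_blinfun_le_on_ball) force
  then have norms: "norm \<phi>1 + norm \<phi>2 \<le> 1" by simp
  have "\<phi>1 (i z) = \<phi>2 (i z)" for z
    using F(2)[of "(i z, - i z)"] by (simp add: S_def split blinfun.minus_right)
  then have eq: "\<phi>1 o\<^sub>L i = \<phi>2 o\<^sub>L i" by (simp add: blinfun_eq_iff)
  obtain \<gamma> :: "'b \<Rightarrow>\<^sub>L real" where \<gamma>: "norm \<gamma> \<le> norm (\<phi>1 o\<^sub>L i)" "\<gamma> o\<^sub>L i = \<phi>1 o\<^sub>L i"
    using norm_preserving_extension[OF iso] by blast
  have n1: "norm \<phi>1 = norm \<gamma> + norm (\<phi>1 - \<gamma>)"
    by (rule M_ideal_norm_extension[OF iso M]) (use \<gamma> in simp_all)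
  have n2: "norm \<phi>2 = norm \<gamma> + norm (\<phi>2 - \<gamma>)"
    by (rule M_ideal_norm_extension[OF iso M]) (use \<gamma> eq in simp_all)
  have \<gamma>i: "\<phi>1 (i x) = \<gamma> (i x)" "\<phi>2 (i x) = \<gamma> (i x)"
    using \<gamma>(2) eq by (simp_all add: blinfun_eq_iff)
  have "\<bar>f u\<bar> \<le> norm f" if "norm u \<le> 1" for f :: "'b \<Rightarrow>\<^sub>L real" and u
    using norm_blinfun[of f u] mult_left_le[OF that, of "norm f"] by simp
  from this[of "i x" \<gamma>] this[OF y, of "\<phi>1 - \<gamma>"] this[OF y, of "\<phi>2 - \<gamma>"]
  have "2 * \<gamma> (i x) + (\<phi>1 - \<gamma>) y - (\<phi>2 - \<gamma>) y \<le> norm \<phi>1 + norm \<phi>2"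
    using x by (simp add: iso n1 n2)
  also have "2 * \<gamma> (i x) + (\<phi>1 - \<gamma>) y - (\<phi>2 - \<gamma>) y = F (i x + y, i x - y)"
    by (simp add: split blinfun.diff_left blinfun.add_right blinfun.diff_right \<gamma>i)
  finally show False using F(3) c norms by simp
qed

text \<open>
  Correct an almost norming vector of \<open>f\<close> by an element of \<open>X\<close>, which \<open>f\<close> does not see, and rescale.
  The conditions \<open>\<parallel>x \<plusminus> y\<parallel> \<le> 1\<close> say that \<open>x\<close> and \<open>y\<close> behave like the unit vectors of a
  two-dimensional \<open>\<ell>\<^sub>\<infinity>\<close>, so that \<open>f\<close> and \<open>g\<close> behave like those of \<open>\<ell>\<^sub>1\<close>.
\<close>

lemma M_ideal_l1_pair:
  fixes i :: "'a::banach \<Rightarrow>\<^sub>L 'b::banach"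
    and f g :: "'b \<Rightarrow>\<^sub>L real" and e :: real
  assumes iso: "\<And>x. norm (i x) = norm x" and M: "M_ideal (range i)"
    and f: "norm f = 1" "f o\<^sub>L i = 0" and g: "norm (g o\<^sub>L i) = 1" and e: "0 < e"
  obtains x y where "norm (i x + y) \<le> 1" "norm (i x - y) \<le> 1" "1 - e < g (i x)" "1 - e < f y"
proof -
  define c where "c = 1 + e / 2"
  have c: "1 < c" using e by (simp add: c_def)
  \<comment> \<open>\<open>c (1 - e) = 1 - e / 2 - e\<^sup>2 / 2\<close>: the loss \<open>e\<close> leaves room for division by \<open>c\<close>.\<close>
  have "c * (1 - e) < 1"
    using e by (simp add: c_def algebra_simps) (smt (verit) mult_pos_pos)
  then obtain u v where u: "norm u \<le> 1" "c * (1 - e) < g (i u)" and v: "norm v \<le> 1" "c * (1 - e) < f v"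
    using almost_norming_vector[of "c * (1 - e)" "g o\<^sub>L i"] almost_norming_vector[of "c * (1 - e)" f] f g
    by (metis blinfun_apply_blinfun_compose)
  obtain z where z: "norm (i u + (v - i z)) < c" "norm (i u - (v - i z)) < c"
    using M_ideal_symmetric_correction[OF iso M u(1) v(1) c] by blast
  have fz: "f (i z) = 0" using f(2) by (simp add: blinfun_eq_iff)
  show ?thesis
  proof (rule that[of "(1 / c) *\<^sub>R u" "(1 / c) *\<^sub>R (v - i z)"])
    have "i ((1 / c) *\<^sub>R u) + (1 / c) *\<^sub>R (v - i z) = (1 / c) *\<^sub>R (i u + (v - i z))"
      "i ((1 / c) *\<^sub>R u) - (1 / c) *\<^sub>R (v - i z) = (1 / c) *\<^sub>R (i u - (v - i z))"
      by (simp_all add: blinfun.scaleR_right scaleR_add_right scaleR_diff_right)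
    moreover have "norm ((1 / c) *\<^sub>R w) \<le> 1" if "norm w < c" for w :: 'b
      using that c by simp
    ultimately show "norm (i ((1 / c) *\<^sub>R u) + (1 / c) *\<^sub>R (v - i z)) \<le> 1"
      "norm (i ((1 / c) *\<^sub>R u) - (1 / c) *\<^sub>R (v - i z)) \<le> 1"
      using z by simp_all
    show "1 - e < g (i ((1 / c) *\<^sub>R u))" "1 - e < f ((1 / c) *\<^sub>R (v - i z))"
      using u v c fz by (simp_all add: blinfun.scaleR_right blinfun.diff_right field_simps)
  qed
qed

section \<open>Powers of functionals on the completed tensor product\<close>

text \<open>
  The continuous extension of \<open>\<otimes>\<^sup>kx \<mapsto> \<phi>(x)\<^sup>k\<close>: elements of the completion are functionals on
  the dual, so the extension of a functional is evaluation at it.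
\<close>

definition power_functional ::
    "('a::real_normed_vector \<Rightarrow>\<^sub>L real) \<Rightarrow> ('k::finite, 'a) sym_inj_tensor \<Rightarrow>\<^sub>L real" where
  "power_functional \<phi> = Blinfun (\<lambda>z. Rep_completion z (Blinfun (power_pairing \<phi>)))"

lemma power_functional_to_completion:
  "power_functional \<phi> (to_completion v) = power_pairing \<phi> v"
  and norm_power_functional_le:
  "norm (power_functional \<phi> :: ('k::finite, 'a::real_normed_vector) sym_inj_tensor \<Rightarrow>\<^sub>L real)
     \<le> norm \<phi> ^ CARD('k)"
  for v :: "('k::finite, 'a::real_normed_vector) sym_tensor"
proof -
  have pl: "\<bar>power_pairing \<phi> w\<bar> \<le> norm w * norm \<phi> ^ CARD('k)" for w :: "('k, 'a) sym_tensor"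
    using abs_power_pairing_le[of \<phi> w] by (simp add: mult.commute)
  have bp: "bounded_linear (power_pairing \<phi> :: ('k, 'a) sym_tensor \<Rightarrow> real)"
    by (rule bounded_linear_intro[where K="norm \<phi> ^ CARD('k)"])
      (simp_all add: linear_add[OF linear_power_pairing] linear_scale[OF linear_power_pairing]
        pl)
  define P where "P = Blinfun (power_pairing \<phi> :: ('k, 'a) sym_tensor \<Rightarrow> real)"
  have P: "P w = power_pairing \<phi> w" for w by (simp add: P_def bounded_linear_Blinfun_apply bp)
  have nP: "norm P \<le> norm \<phi> ^ CARD('k)"
    by (rule norm_blinfun_bound) (simp_all add: P abs_power_pairing_le)
  have le: "\<bar>Rep_completion z P\<bar> \<le> norm z * norm P" for z
    using norm_blinfun[of "Rep_completion z" P] by (simp add: norm_completion.rep_eq)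
  have "bounded_linear (\<lambda>z. Rep_completion z P)"
    by (rule bounded_linear_intro[where K="norm P"])
      (simp_all add: plus_completion.rep_eq scaleR_completion.rep_eq blinfun.add_left
        blinfun.scaleR_left le)
  then have app: "power_functional \<phi> z = Rep_completion z P" for z
    by (simp add: power_functional_def bounded_linear_Blinfun_apply flip: P_def)
  show "power_functional \<phi> (to_completion v) = power_pairing \<phi> v"
    by (simp add: app to_completion.rep_eq bidual_embedding.rep_eq P)
  show "norm (power_functional \<phi> :: ('k, 'a) sym_inj_tensor \<Rightarrow>\<^sub>L real) \<le> norm \<phi> ^ CARD('k)"
  proof (rule norm_blinfun_bound)
    fix z :: "('k, 'a) sym_inj_tensor"
    show "norm (power_functional \<phi> z) \<le> norm \<phi> ^ CARD('k) * norm z"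
      using le[of z] mult_left_mono[OF nP, of "norm z"] by (simp add: app mult.commute)
  qed simp
qed

lemma norm_sym_power_le: "norm (sym_power x :: ('k::finite, 'a::real_normed_vector) sym_tensor) \<le> norm x ^ CARD('k)"
  by (rule norm_sym_tensor_le) (simp add: power_abs power_mono abs_blinfun_le_norm)

text \<open>
  The lower bound comes from the elementary tensors, whose norm is at most \<open>\<parallel>x\<parallel>\<^sup>k\<close>.
\<close>

lemma norm_power_functional:
  "norm (power_functional \<phi> :: ('k::finite, 'a::real_normed_vector) sym_inj_tensor \<Rightarrow>\<^sub>L real)
     = norm \<phi> ^ CARD('k)"
proof (rule antisym[OF norm_power_functional_le])
  let ?\<Phi> = "power_functional \<phi> :: ('k, 'a) sym_inj_tensor \<Rightarrow>\<^sub>L real"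
  define r where "r = root CARD('k) (norm ?\<Phi>)"
  have r: "0 \<le> r" "r ^ CARD('k) = norm ?\<Phi>" by (simp_all add: r_def)
  have "norm \<phi> \<le> r"
  proof (rule norm_blinfun_bound[OF r(1)])
    fix x
    have "\<bar>\<phi> x\<bar> ^ CARD('k) = \<bar>?\<Phi> (to_completion (sym_power x))\<bar>"
      by (simp add: power_functional_to_completion power_abs)
    also have "\<dots> \<le> norm ?\<Phi> * norm (sym_power x :: ('k, 'a) sym_tensor)"
      using norm_blinfun[of ?\<Phi> "to_completion (sym_power x)"] by (simp add: norm_to_completion)
    also have "\<dots> \<le> (r * norm x) ^ CARD('k)"
      by (simp add: r(2) power_mult_distrib mult_left_mono norm_sym_power_le)
    finally show "norm (\<phi> x) \<le> r * norm x"
      using r(1) by (simp add: power_mono_iff)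
  qed
  then show "norm \<phi> ^ CARD('k) \<le> norm ?\<Phi>" unfolding r(2)[symmetric] by (rule power_mono) simp
qed

lemma power_functional_compose:
  fixes i :: "'a::real_normed_vector \<Rightarrow>\<^sub>L 'b::real_normed_vector"
  shows "power_functional \<phi> o\<^sub>L (sym_inj_tensor_map i :: ('k::finite, 'a) sym_inj_tensor \<Rightarrow>\<^sub>L ('k, 'b) sym_inj_tensor)
     = power_functional (\<phi> o\<^sub>L i)"
proof -
  have eq: "power_functional \<phi> (sym_inj_tensor_map i (to_completion v)) = power_functional (\<phi> o\<^sub>L i) (to_completion v)"
    for v :: "('k, 'a) sym_tensor"
    unfolding sym_inj_tensor_map_def completion_map_to_completion power_functional_to_completion
    by (rule power_pairing_compose)
      (simp_all add: sym_tensor_map_sym_power bounded_linear.linear blinfun.bounded_linear_right)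
  show ?thesis
  proof (rule blinfun_eqI)
    fix z :: "('k, 'a) sym_inj_tensor"
    let ?E = "{z :: ('k, 'a) sym_inj_tensor. power_functional \<phi> (sym_inj_tensor_map i z) = power_functional (\<phi> o\<^sub>L i) z}"
    have "closed ?E" by (intro closed_Collect_eq continuous_intros)
    moreover have "range to_completion \<subseteq> ?E" using eq by auto
    ultimately have "closure (range to_completion) \<subseteq> ?E" by (rule closure_minimal[rotated])
    then show "(power_functional \<phi> o\<^sub>L sym_inj_tensor_map i) z = power_functional (\<phi> o\<^sub>L i) z"
      unfolding closure_range_to_completion by auto
  qed
qed

section \<open>A test polynomial without pure powers\<close>

definition mixed_part :: "nat \<Rightarrow> real \<Rightarrow> real \<Rightarrow> real" where
  "mixed_part k s t = (s + t) ^ k - s ^ k - t ^ k"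

text \<open>
  The point \<open>(1/2, 1/2)\<close> shows that the maximum is positive: the value there is \<open>1 - 2 / 2\<^sup>k\<close>. A maximum
  point therefore lies off the axes, where the polynomial vanishes.
\<close>

lemma mixed_part_maximum:
  assumes "1 < k"
  obtains a b where "\<bar>a\<bar> + \<bar>b\<bar> \<le> 1" "b \<noteq> 0" "mixed_part k a b \<noteq> 0"
    "\<And>s t. \<bar>s\<bar> + \<bar>t\<bar> \<le> 1 \<Longrightarrow> \<bar>mixed_part k s t\<bar> \<le> \<bar>mixed_part k a b\<bar>"
proof -
  let ?D = "{w :: real \<times> real. \<bar>fst w\<bar> + \<bar>snd w\<bar> \<le> 1}"
  have "closed ?D" by (intro closed_Collect_le continuous_intros)
  moreover have "bounded ?D"
    unfolding bounded_iff by (rule exI[of _ 1]) (auto intro: order_trans[OF norm_Pair_le])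
  ultimately have "compact ?D" by (simp add: compact_eq_bounded_closed)
  moreover have "(1/2, 1/2) \<in> ?D" by simp
  moreover have "continuous_on ?D (\<lambda>w. \<bar>mixed_part k (fst w) (snd w)\<bar>)"
    unfolding mixed_part_def by (intro continuous_intros)
  ultimately obtain w where w: "w \<in> ?D"
    "\<And>v. v \<in> ?D \<Longrightarrow> \<bar>mixed_part k (fst v) (snd v)\<bar> \<le> \<bar>mixed_part k (fst w) (snd w)\<bar>"
    using continuous_attains_sup[of ?D "\<lambda>w. \<bar>mixed_part k (fst w) (snd w)\<bar>"] by blast
  have "(1/2::real) ^ k < (1/2) ^ 1" by (rule power_strict_decreasing) (use assms in auto)
  then have "0 < mixed_part k (1/2) (1/2)" by (simp add: mixed_part_def)
  then have nz: "mixed_part k (fst w) (snd w) \<noteq> 0" using w(2)[of "(1/2, 1/2)"] by auto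
  moreover have "mixed_part k s 0 = 0" for s using assms by (simp add: mixed_part_def)
  ultimately have "snd w \<noteq> 0" by metis
  then show ?thesis using that[of "fst w" "snd w"] w nz by fastforce
qed

definition mixed_tensor :: "'a::real_normed_vector \<Rightarrow> 'a \<Rightarrow> ('k::finite, 'a) sym_tensor" where
  "mixed_tensor y x = sym_power (y + x) - sym_power y - sym_power x"

lemma power_pairing_mixed_tensor:
  "power_pairing \<phi> (mixed_tensor y x :: ('k::finite, 'a::real_normed_vector) sym_tensor)
     = mixed_part CARD('k) (\<phi> y) (\<phi> x)"
  by (simp add: mixed_tensor_def mixed_part_def linear_diff[OF linear_power_pairing] blinfun.add_right)

text \<open>
  The norm conditions on \<open>x\<close> and \<open>y\<close> put \<open>(\<phi> y, \<phi> x)\<close> in the diamond for every \<open>\<phi>\<close> in the dual unit ball.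
\<close>

lemma norm_mixed_tensor_le:
  assumes m: "\<And>s t. \<bar>s\<bar> + \<bar>t\<bar> \<le> 1 \<Longrightarrow> \<bar>mixed_part CARD('k) s t\<bar> \<le> m"
    and xy: "norm (x + y) \<le> 1" "norm (x - y) \<le> 1"
  shows "norm (mixed_tensor y x :: ('k::finite, 'a::real_normed_vector) sym_tensor) \<le> m"
proof (rule norm_sym_tensor_le)
  fix \<phi> :: "'a \<Rightarrow>\<^sub>L real" assume "norm \<phi> \<le> 1"
  then have "\<bar>\<phi> (x + y)\<bar> \<le> 1" "\<bar>\<phi> (x - y)\<bar> \<le> 1"
    using abs_blinfun_le_norm xy by (blast intro: order_trans)+
  then have "\<bar>\<phi> y\<bar> + \<bar>\<phi> x\<bar> \<le> 1"
    by (simp add: blinfun.add_right blinfun.diff_right)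
  then show "\<bar>power_pairing \<phi> (mixed_tensor y x :: ('k, 'a) sym_tensor)\<bar> \<le> m"
    unfolding power_pairing_mixed_tensor by (rule m)
qed

section \<open>Symmetric injective tensor products of M-ideals\<close>

theorem theorem2p5:
  fixes i :: "'a::banach \<Rightarrow>\<^sub>L 'b::banach"
  assumes "CARD('k::finite) > 1"
    and "\<And>x. norm (blinfun_apply i x) = norm x"
    and "M_ideal (range (blinfun_apply i))"
    and "range (blinfun_apply i) \<noteq> {0}"
    and "range (blinfun_apply i) \<noteq> UNIV"
  shows "\<not> M_ideal (range (blinfun_apply
           (sym_inj_tensor_map i :: ('k, 'a) sym_inj_tensor \<Rightarrow>\<^sub>L ('k, 'b) sym_inj_tensor)))"
proof
  let ?J = "sym_inj_tensor_map i :: ('k, 'a) sym_inj_tensor \<Rightarrow>\<^sub>L ('k, 'b) sym_inj_tensor"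
  let ?k = "CARD('k)"
  assume M: "M_ideal (range ?J)"
  note iso = assms(2)
  obtain f :: "'b \<Rightarrow>\<^sub>L real" where f: "norm f = 1" "\<And>x. f (i x) = 0"
    using annihilating_functional[of i] assms(3,5) unfolding M_ideal_def by blast
  then have fi: "f o\<^sub>L i = 0" by (simp add: blinfun_eq_iff)
  have "\<exists>v. i v \<noteq> 0" using assms(4) by auto
  then obtain v :: 'a where v: "v \<noteq> 0" by (metis blinfun.zero_right)
  obtain h :: "'a \<Rightarrow>\<^sub>L real" where h: "norm h \<le> 1" "h v = norm v" by (rule hahn_banach_norming)
  have "1 \<le> norm h" using norm_blinfun[of h v] h v by simp
  then have nh: "norm h = 1" using h by simp
  obtain g :: "'b \<Rightarrow>\<^sub>L real" where g: "norm g \<le> 1" "g o\<^sub>L i = h"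
    using norm_preserving_extension[OF iso, of h] nh by metis
  obtain a b where ab: "\<bar>a\<bar> + \<bar>b\<bar> \<le> 1" "b \<noteq> 0" "mixed_part ?k a b \<noteq> 0"
    "\<And>s t. \<bar>s\<bar> + \<bar>t\<bar> \<le> 1 \<Longrightarrow> \<bar>mixed_part ?k s t\<bar> \<le> \<bar>mixed_part ?k a b\<bar>"
    using mixed_part_maximum[OF assms(1)] by blast
  define m where "m = \<bar>mixed_part ?k a b\<bar>"
  define \<phi> where "\<phi> = a *\<^sub>R f + b *\<^sub>R g"
  define \<psi> where "\<psi> = b *\<^sub>R g"
  let ?\<Phi> = "power_functional \<phi> :: ('k, 'b) sym_inj_tensor \<Rightarrow>\<^sub>L real"
  let ?\<Psi> = "power_functional \<psi> :: ('k, 'b) sym_inj_tensor \<Rightarrow>\<^sub>L real"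
  have \<phi>\<psi>: "\<phi> o\<^sub>L i = b *\<^sub>R h" "\<psi> o\<^sub>L i = b *\<^sub>R h"
    unfolding \<phi>_def \<psi>_def g(2)[symmetric]
    by (simp_all add: blinfun_eq_iff blinfun.add_left blinfun.scaleR_left f(2))
  \<comment> \<open>Restriction to \<open>X\<close> does not decrease the norm of \<open>\<psi>\<close>, hence not that of its power either.\<close>
  have n\<psi>: "norm \<psi> = \<bar>b\<bar>"
  proof (rule antisym)
    show "norm \<psi> \<le> \<bar>b\<bar>" using g(1) by (simp add: \<psi>_def mult_left_le)
    have "norm (\<psi> o\<^sub>L i) \<le> norm \<psi> * 1"
      by (rule norm_blinfun_bound) (use norm_blinfun[of \<psi> "i _"] iso in auto)
    then show "\<bar>b\<bar> \<le> norm \<psi>" by (simp add: \<phi>\<psi> nh)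
  qed
  have "norm \<phi> \<le> \<bar>a\<bar> * norm f + \<bar>b\<bar> * norm g"
    unfolding \<phi>_def using norm_triangle_ineq[of "a *\<^sub>R f" "b *\<^sub>R g"] by simp
  also have "\<dots> \<le> 1" using f(1) mult_left_le[OF g(1), of "\<bar>b\<bar>"] ab(1) by simp
  finally have "norm ?\<Phi> \<le> 1" by (simp add: norm_power_functional power_le_one)
  moreover have "norm ?\<Phi> = norm ?\<Psi> + norm (?\<Phi> - ?\<Psi>)"
    by (rule M_ideal_norm_extension[OF norm_sym_inj_tensor_map[OF iso] M])
      (simp_all add: power_functional_compose norm_power_functional \<phi>\<psi> n\<psi> nh)
  ultimately have diff: "norm (?\<Phi> - ?\<Psi>) \<le> 1 - \<bar>b\<bar> ^ ?k"
    by (simp add: norm_power_functional n\<psi>)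
  have "\<exists>x y. norm (i x + y) \<le> 1 \<and> norm (i x - y) \<le> 1 \<and> 1 - 1 / real (Suc n) < g (i x) \<and> 1 - 1 / real (Suc n) < f y" for n
  proof -
    have "norm (g o\<^sub>L i) = 1" "0 < 1 / real (Suc n)" using nh by (simp_all add: g(2))
    from M_ideal_l1_pair[OF iso assms(3) f(1) fi this] show ?thesis by metis
  qed
  then obtain x y where xy: "\<And>n. norm (i (x n) + y n) \<le> 1" "\<And>n. norm (i (x n) - y n) \<le> 1"
    "\<And>n. 1 - 1 / real (Suc n) < g (i (x n))" "\<And>n. 1 - 1 / real (Suc n) < f (y n)" by metis
  have test: "\<bar>mixed_part ?k (\<phi> (y n)) (\<phi> (i (x n))) - mixed_part ?k (\<psi> (y n)) (\<psi> (i (x n)))\<bar>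
      \<le> (1 - \<bar>b\<bar> ^ ?k) * m" for n
  proof -
    let ?w = "to_completion (mixed_tensor (y n) (i (x n)) :: ('k, 'b) sym_tensor)"
    have "norm ?w \<le> m"
      unfolding norm_to_completion m_def using norm_mixed_tensor_le[OF ab(4) xy(1,2)] .
    then have "norm (?\<Phi> - ?\<Psi>) * norm ?w \<le> (1 - \<bar>b\<bar> ^ ?k) * m"
      using order_trans[OF norm_ge_zero diff] by (intro mult_mono diff) auto
    then show ?thesis
      using norm_blinfun[of "?\<Phi> - ?\<Psi>" ?w]
      by (simp add: blinfun.diff_left power_functional_to_completion power_pairing_mixed_tensor)
  qed
  have inv: "(\<lambda>n. 1 / real (Suc n)) \<longlonglongrightarrow> 0" using LIMSEQ_inverse_real_of_nat by (simp add: inverse_eq_divide)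
  \<comment> \<open>\<open>\<bar>s\<bar> + \<bar>t\<bar>\<close> is the larger of \<open>\<bar>s + t\<bar>\<close> and \<open>\<bar>s - t\<bar>\<close>.\<close>
  have bnd: "\<bar>F (i (x n))\<bar> + \<bar>F (y n)\<bar> \<le> 1" if "norm F \<le> 1" for F :: "'b \<Rightarrow>\<^sub>L real" and n
    using abs_blinfun_le_norm[OF that, of "i (x n) + y n"] abs_blinfun_le_norm[OF that, of "i (x n) - y n"]
      xy(1,2)[of n] by (simp add: blinfun.add_right blinfun.diff_right)
  have gx: "(\<lambda>n. g (i (x n))) \<longlonglongrightarrow> 1"
  proof (rule tendsto_sandwich[where f="\<lambda>n. 1 - 1 / real (Suc n)" and h="\<lambda>_. 1"])
    show "(\<lambda>n. 1 - 1 / real (Suc n)) \<longlonglongrightarrow> 1" using tendsto_diff[OF tendsto_const inv, of 1] by simp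
    show "\<forall>\<^sub>F n in sequentially. g (i (x n)) \<le> 1" using bnd[OF g(1)] by (smt (verit) always_eventually)
  qed (use xy(3) in \<open>auto intro!: always_eventually less_imp_le\<close>)
  have fy: "(\<lambda>n. f (y n)) \<longlonglongrightarrow> 1"
  proof (rule tendsto_sandwich[where f="\<lambda>n. 1 - 1 / real (Suc n)" and h="\<lambda>_. 1"])
    show "(\<lambda>n. 1 - 1 / real (Suc n)) \<longlonglongrightarrow> 1" using tendsto_diff[OF tendsto_const inv, of 1] by simp
    show "\<forall>\<^sub>F n in sequentially. f (y n) \<le> 1" using bnd[of f] f(1) by (smt (verit) always_eventually)
  qed (use xy(4) in \<open>auto intro!: always_eventually less_imp_le\<close>)
  \<comment> \<open>The diamond condition leaves no room for \<open>g y\<close> once \<open>g x\<close> is close to \<open>1\<close>.\<close>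
  have gy: "(\<lambda>n. g (y n)) \<longlonglongrightarrow> 0"
  proof (rule Lim_null_comparison[OF always_eventually inv], rule allI)
    show "norm (g (y n)) \<le> 1 / real (Suc n)" for n using bnd[OF g(1), of n] xy(3)[of n] by simp
  qed
  have "(\<lambda>n. \<phi> (y n)) \<longlonglongrightarrow> a * 1 + b * 0" "(\<lambda>n. \<phi> (i (x n))) \<longlonglongrightarrow> a * 0 + b * 1"
    "(\<lambda>n. \<psi> (y n)) \<longlonglongrightarrow> b * 0" "(\<lambda>n. \<psi> (i (x n))) \<longlonglongrightarrow> b * 1"
    unfolding \<phi>_def \<psi>_def blinfun.add_left blinfun.scaleR_left real_scaleR_def f(2)
    by (intro tendsto_intros gx gy fy)+
  then have "(\<lambda>n. \<bar>mixed_part ?k (\<phi> (y n)) (\<phi> (i (x n))) - mixed_part ?k (\<psi> (y n)) (\<psi> (i (x n)))\<bar>)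
      \<longlonglongrightarrow> \<bar>mixed_part ?k (a * 1 + b * 0) (a * 0 + b * 1) - mixed_part ?k (b * 0) (b * 1)\<bar>"
    unfolding mixed_part_def by (intro tendsto_intros)
  moreover have "mixed_part ?k 0 b = 0" by (simp add: mixed_part_def)
  ultimately have "(\<lambda>n. \<bar>mixed_part ?k (\<phi> (y n)) (\<phi> (i (x n))) - mixed_part ?k (\<psi> (y n)) (\<psi> (i (x n)))\<bar>) \<longlonglongrightarrow> m"
    by (simp add: m_def)
  then have "m \<le> (1 - \<bar>b\<bar> ^ ?k) * m"
    by (rule tendsto_upperbound) (simp_all add: test)
  then have "\<bar>b\<bar> ^ ?k * m \<le> 0" by (simp add: algebra_simps)
  moreover have "0 < \<bar>b\<bar> ^ ?k * m" using ab(2,3) by (simp add: m_def)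
  ultimately show False by simp
qed

end
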